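(* Let $K$ be a field, $T=K[x_0,\ldots,x_n]$, $S=K[y_0,\ldots,y_n]$ acting on $T$ by differentiation, and let $F\in T$ be a nonzero homogeneous form with annihilator ideal $F^{\bot}\subset S$. Let $d\ge 1$ be an integer such that the ideal $F^{\bot}$ is generated in degree $d$. Then the cactus rank of $F$ satisfies $$cr(F)\;\geq\; \frac{1}{d}\,\deg F^{\bot}.$$
   Context: The ring $S=K[y_0,\ldots,y_n]$ is regarded as the ring of commuting differential operators acting on $T=K[x_0,\ldots,x_n]$, with $y_i$ acting as $\partial/\partial x_i$ (this action is called apolarity). It makes $S$, with its standard grading, the homogeneous coordinate ring of the projective space $\mathbf{P}(T_1)$ of $1$-dimensional subspaces of the space $T_1$ of linear forms, so $\mathbf{P}(T_1)\cong \operatorname{Proj} S\cong\mathbf{P}^n_K$. The annihilator of $F$ is the homogeneous ideal $F^{\bot}=\{g\in S : g\cdot F=0\}\subset S$. The quotient $S_F=S/F^{\bot}$ is a finite-dimensional $K$-algebra, and the degree of $F^{\bot}$ is defined as its length: $\deg F^{\bot}=\dim_K S/F^{\bot}$. "$F^{\bot}$ is generated in degree $d$" means that $F^{\bot}$ can be generated by homogeneous elements of degree at most $d$. A finite (i.e. zero-dimensional) closed subscheme $\Gamma\subset\mathbf{P}(T_1)$ is apolar to $F$ if its (saturated) homogeneous ideal $I_\Gamma\subset S$ satisfies $I_\Gamma\subset F^{\bot}$. The degree of $\Gamma$ is its length, $\deg\Gamma=\dim_K H^0(\Gamma,\mathcal{O}_\Gamma)$. The cactus rank of $F$ is $$cr(F)=\min\{\deg\Gamma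 \mid \Gamma\subset\mathbf{P}(T_1),\ \dim\Gamma=0,\ I_\Gamma\subset F^{\bot}\}.$$ *)

theory Defs
  imports Complex_Main "HOL-Library.Poly_Mapping" "HOL-Library.Extended_Real"
    "HOL-Algebra.Embedded_Algebras" "HOL-Algebra.QuotRing" "HOL-Algebra.Algebraic_Closure_Type"
begin

section \<open>Polynomials and apolarity\<close>

text \<open>
  The index type \<open>'v\<close> is finite and non-empty and plays the role of \<open>{0,\<dots>,n}\<close>.  Both
  \<open>T = K[x\<^sub>0,\<dots>,x\<^sub>n]\<close> and \<open>S = K[y\<^sub>0,\<dots>,y\<^sub>n]\<close> are represented by this type.
\<close>

type_synonym ('v, 'k) mpoly = "('v \<Rightarrow>\<^sub>0 nat) \<Rightarrow>\<^sub>0 'k"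

abbreviation poly_ring :: "('v, 'k::field) mpoly ring" (\<open>\<S>\<close>)
  where "\<S> \<equiv> ring_of_type_algebra"

definition const :: "'k \<Rightarrow> ('v, 'k::field) mpoly"
  where "const c = Poly_Mapping.single 0 c"

definition var :: "'v \<Rightarrow> ('v, 'k::field) mpoly"
  where "var i = Poly_Mapping.single (Poly_Mapping.single i 1) 1"

definition mdeg :: "('v::finite \<Rightarrow>\<^sub>0 nat) \<Rightarrow> nat"
  where "mdeg \<alpha> = (\<Sum>i\<in>UNIV. Poly_Mapping.lookup \<alpha> i)"

definition homogeneous :: "nat \<Rightarrow> ('v::finite, 'k::field) mpoly \<Rightarrow> bool"
  where "homogeneous e p \<longleftrightarrow> (\<forall>\<alpha>\<in>Poly_Mapping.keys p. mdeg \<alpha> = e)"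

definition hcomp :: "nat \<Rightarrow> ('v::finite, 'k::field) mpoly \<Rightarrow> ('v, 'k) mpoly"
  where "hcomp e p =
    (\<Sum>\<alpha>\<in>{\<alpha>\<in>Poly_Mapping.keys p. mdeg \<alpha> = e}. Poly_Mapping.single \<alpha> (Poly_Mapping.lookup p \<alpha>))"

definition partial :: "'v \<Rightarrow> ('v::finite, 'k::field) mpoly \<Rightarrow> ('v, 'k) mpoly"
  where "partial i F = (\<Sum>\<alpha>\<in>Poly_Mapping.keys F.
    Poly_Mapping.single (\<alpha> - Poly_Mapping.single i 1)
      (of_nat (Poly_Mapping.lookup \<alpha> i) * Poly_Mapping.lookup F \<alpha>))"

lemma lookup_partial:
  "Poly_Mapping.lookup (partial i F) \<beta> =
    of_nat (Suc (Poly_Mapping.lookup \<beta> i)) * Poly_Mapping.lookup F (\<beta> + Poly_Mapping.single i 1)"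
proof -
  let ?\<gamma> = "\<beta> + Poly_Mapping.single i 1"
  have eq: "(if \<alpha> - Poly_Mapping.single i 1 = \<beta>
          then of_nat (Poly_Mapping.lookup \<alpha> i) * Poly_Mapping.lookup F \<alpha> else 0) =
      (if \<alpha> = ?\<gamma> then of_nat (Poly_Mapping.lookup \<alpha> i) * Poly_Mapping.lookup F \<alpha> else 0)" for \<alpha>
  proof (cases "Poly_Mapping.lookup \<alpha> i = 0")
    case False
    have "\<alpha> - Poly_Mapping.single i 1 + Poly_Mapping.single i 1 = \<alpha>"
      using False
      by (intro poly_mapping_eqI) (auto simp: lookup_add lookup_minus lookup_single when_def)
    then have "\<alpha> - Poly_Mapping.single i 1 = \<beta> \<longleftrightarrow> \<alpha> = ?\<gamma>"
      by (metis add_diff_cancel_right')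
    then show ?thesis by simp
  qed auto
  have "Poly_Mapping.lookup (partial i F) \<beta> =
      (\<Sum>\<alpha>\<in>Poly_Mapping.keys F. if \<alpha> = ?\<gamma>
        then of_nat (Poly_Mapping.lookup \<alpha> i) * Poly_Mapping.lookup F \<alpha> else 0)"
    unfolding partial_def lookup_sum lookup_single when_def by (rule sum.cong) (simp_all only: eq)
  also have "\<dots> = of_nat (Poly_Mapping.lookup ?\<gamma> i) * Poly_Mapping.lookup F ?\<gamma>"
    by (subst sum.delta) (auto simp: in_keys_iff)
  finally show ?thesis by (simp add: lookup_add)
qed

lemma partial_commute: "partial i (partial j F) = partial j (partial i F)"
proof (cases "i = j")
  case False
  then show ?thesis
    by (intro poly_mapping_eqI) (simp add: lookup_partial lookup_add lookup_single algebra_simps)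
qed simp

lemma partial_power_commute:
  "(partial i ^^ a) ((partial j ^^ b) F) = (partial j ^^ b) ((partial i ^^ a) F)"
proof -
  have 1: "partial i ((partial j ^^ b) F) = (partial j ^^ b) (partial i F)" for F
    by (induction b) (simp_all add: partial_commute[of i j])
  show ?thesis by (induction a) (simp_all add: 1)
qed

text \<open>The operator \<open>\<Prod>\<^sub>i \<partial>\<^sub>i\<^bsup>\<alpha> i\<^esup>\<close>; the fold is over commuting maps.\<close>

definition partial_monom :: "('v::finite \<Rightarrow>\<^sub>0 nat) \<Rightarrow> ('v, 'k::field) mpoly \<Rightarrow> ('v, 'k) mpoly"
  where "partial_monom \<alpha> F =
    Finite_Set.fold (\<lambda>i. partial i ^^ Poly_Mapping.lookup \<alpha> i) F UNIV"

lemma comp_fun_commute_partial: "comp_fun_commute (\<lambda>i. partial i ^^ a i)"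
  by unfold_locales (simp add: fun_eq_iff partial_power_commute)

definition apolar_act :: "('v::finite, 'k::field) mpoly \<Rightarrow> ('v, 'k) mpoly \<Rightarrow> ('v, 'k) mpoly"
    (infixr \<open>\<bullet>\<close> 70)
  where "g \<bullet> F = (\<Sum>\<alpha>\<in>Poly_Mapping.keys g. const (Poly_Mapping.lookup g \<alpha>) * partial_monom \<alpha> F)"

lemma fold_partial_insert:
  assumes "finite A" "x \<notin> A"
  shows "Finite_Set.fold (\<lambda>i. partial i ^^ a i) F (insert x A) =
    (partial x ^^ a x) (Finite_Set.fold (\<lambda>i. partial i ^^ a i) F A)"
proof -
  interpret comp_fun_commute "\<lambda>i. partial i ^^ a i" by (rule comp_fun_commute_partial)
  show ?thesis using assms by simp
qed

lemma fold_partial_out: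
  assumes "finite A"
  shows "Finite_Set.fold (\<lambda>i. partial i ^^ a i) ((partial j ^^ b) F) A =
    (partial j ^^ b) (Finite_Set.fold (\<lambda>i. partial i ^^ a i) F A)"
  using assms by induction (simp_all add: fold_partial_insert partial_power_commute)

lemma partial_monom_add: "partial_monom (\<alpha> + \<beta>) F = partial_monom \<alpha> (partial_monom \<beta> F)"
proof -
  have "Finite_Set.fold (\<lambda>i. partial i ^^ (a i + b i)) F A =
    Finite_Set.fold (\<lambda>i. partial i ^^ a i) (Finite_Set.fold (\<lambda>i. partial i ^^ b i) F A) A"
    if "finite A" for a b A
    using that
  proof induction
    case (insert x A)
    show ?case
      unfolding fold_partial_insert[OF insert(1,2)] insert.IH fold_partial_out[OF insert(1)]
      by (simp add: funpow_add)
  qed simp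
  from this[OF finite_UNIV] show ?thesis unfolding partial_monom_def lookup_add .
qed

lemma partial_monom_single: "partial_monom (Poly_Mapping.single i k) F = (partial i ^^ k) F"
proof -
  have "Finite_Set.fold (\<lambda>j. partial j ^^ Poly_Mapping.lookup (Poly_Mapping.single i k) j) F A =
      (if i \<in> A then (partial i ^^ k) F else F)" if "finite A" for A
    using that
  proof induction
    case (insert x A)
    show ?case unfolding fold_partial_insert[OF insert(1,2)] insert.IH
      using insert(2) by (cases "x = i") (auto simp: lookup_single_not_eq)
  qed simp
  from this[OF finite_UNIV] show ?thesis unfolding partial_monom_def by simp
qed

lemma lookup_const_mult:
  "Poly_Mapping.lookup (const c * F) \<alpha> = c * Poly_Mapping.lookup F \<alpha>"
  unfolding const_def mult_map_scale_conv_mult[symmetric] by (simp add: Poly_Mapping.map.rep_eq when_def)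

lemma partial_linear:
  "partial i 0 = 0" "partial i (F + G) = partial i F + partial i G"
  "partial i (const c * F) = const c * partial i F"
  by (intro poly_mapping_eqI; simp add: lookup_partial lookup_add lookup_const_mult distrib_left distrib_right mult.left_commute)+

lemma partial_power_linear:
  "(partial i ^^ k) 0 = 0" "(partial i ^^ k) (F + G) = (partial i ^^ k) F + (partial i ^^ k) G"
  "(partial i ^^ k) (const c * F) = const c * (partial i ^^ k) F"
  by (induction k) (simp_all add: partial_linear)

lemma partial_monom_linear:
  "partial_monom \<alpha> 0 = 0" "partial_monom \<alpha> (F + G) = partial_monom \<alpha> F + partial_monom \<alpha> G"
  "partial_monom \<alpha> (const c * F) = const c * partial_monom \<alpha> F"
proof -
  have "Finite_Set.fold (\<lambda>i. partial i ^^ a i) 0 A = 0 \<and>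
     Finite_Set.fold (\<lambda>i. partial i ^^ a i) (F + G) A =
       Finite_Set.fold (\<lambda>i. partial i ^^ a i) F A + Finite_Set.fold (\<lambda>i. partial i ^^ a i) G A \<and>
     Finite_Set.fold (\<lambda>i. partial i ^^ a i) (const c * F) A =
       const c * Finite_Set.fold (\<lambda>i. partial i ^^ a i) F A" if "finite A" for a A
    using that by induction (simp_all add: fold_partial_insert partial_power_linear)
  from this[OF finite_UNIV] show "partial_monom \<alpha> 0 = 0" "partial_monom \<alpha> (F + G) = partial_monom \<alpha> F + partial_monom \<alpha> G"
    "partial_monom \<alpha> (const c * F) = const c * partial_monom \<alpha> F"
    unfolding partial_monom_def by blast+
qed

lemma apolar_act_superset:
  "finite A \<Longrightarrow> Poly_Mapping.keys g \<subseteq> A \<Longrightarrow>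
    g \<bullet> F = (\<Sum>\<alpha>\<in>A. const (Poly_Mapping.lookup g \<alpha>) * partial_monom \<alpha> F)"
  unfolding apolar_act_def by (rule sum.mono_neutral_left) (auto simp: in_keys_iff const_def)

lemma apolar_act_add: "(g + h) \<bullet> F = g \<bullet> F + h \<bullet> F"
proof -
  let ?A = "Poly_Mapping.keys g \<union> Poly_Mapping.keys h"
  have 1: "finite ?A" by simp
  have "Poly_Mapping.keys (g + h) \<subseteq> ?A" by (rule keys_add)
  then show ?thesis
    by (simp add: apolar_act_superset[OF 1] lookup_add const_def single_add sum.distrib algebra_simps)
qed

lemma apolar_act_single: "Poly_Mapping.single \<alpha> c \<bullet> F = const c * partial_monom \<alpha> F"
  unfolding apolar_act_def by (auto simp: const_def)

lemma apolar_act_zero: "0 \<bullet> F = 0" "g \<bullet> 0 = 0"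
  unfolding apolar_act_def by (auto simp: partial_monom_linear)

lemma apolar_act_add_right: "g \<bullet> (F + G) = g \<bullet> F + g \<bullet> G"
  unfolding apolar_act_def by (simp add: partial_monom_linear sum.distrib algebra_simps)

lemma mpoly_induct:
  assumes "P 0" "\<And>\<alpha> c. P (Poly_Mapping.single \<alpha> c)" "\<And>p q. P p \<Longrightarrow> P q \<Longrightarrow> P (p + q)"
  shows "P (p :: ('v, 'k::field) mpoly)"
proof -
  have "P (\<Sum>\<alpha>\<in>A. Poly_Mapping.single \<alpha> (Poly_Mapping.lookup p \<alpha>))" if "finite A" for A
    using that by induction (auto intro: assms)
  moreover have "(\<Sum>\<alpha>\<in>Poly_Mapping.keys p. Poly_Mapping.single \<alpha> (Poly_Mapping.lookup p \<alpha>)) = p"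
    by (rule poly_mapping_eqI) (auto simp: lookup_sum lookup_single when_def in_keys_iff)
  ultimately show ?thesis by (metis finite_keys)
qed

lemma apolar_act_var: "var i \<bullet> F = partial i F"
  unfolding var_def by (simp add: apolar_act_single partial_monom_single const_def)

lemma apolar_act_const: "const c \<bullet> F = const c * F"
proof -
  have "partial_monom 0 F = F"
    using partial_monom_single[of undefined 0 F] by simp
  then show ?thesis by (simp add: const_def apolar_act_single[unfolded const_def])
qed

lemma apolar_act_mult: "(g * h) \<bullet> F = g \<bullet> (h \<bullet> F)"
proof (induction g rule: mpoly_induct)
  case (2 \<alpha> c)
  show ?case
  proof (induction h rule: mpoly_induct)
    case (2 \<beta> d)
    have "const (c * d) = const c * (const d :: ('a, 'b) mpoly)" by (simp add: const_def mult_single)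
    then show ?case
      by (simp add: mult_single apolar_act_single partial_monom_add partial_monom_linear mult.assoc)
  qed (simp_all add: apolar_act_zero apolar_act_add apolar_act_add_right algebra_simps)
qed (simp_all add: apolar_act_zero apolar_act_add algebra_simps)

definition annihilator :: "('v::finite, 'k::field) mpoly \<Rightarrow> ('v, 'k) mpoly set"
  where "annihilator F = {g. g \<bullet> F = 0}"

definition generated_in_degree :: "nat \<Rightarrow> ('v::finite, 'k::field) mpoly set \<Rightarrow> bool"
  where "generated_in_degree d I \<longleftrightarrow>
    (\<exists>G. (\<forall>g\<in>G. \<exists>e\<le>d. homogeneous e g) \<and> I = Idl\<^bsub>\<S>\<^esub> G)"

definition annihilator_degree :: "('v::finite, 'k::field) mpoly \<Rightarrow> nat"
  where "annihilator_degree F =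
    ring.dim (\<S> Quot annihilator F) (range (\<lambda>c. annihilator F +>\<^bsub>\<S>\<^esub> const c))
      (carrier (\<S> Quot annihilator F))"


section \<open>Closed subschemes of projective space\<close>

text \<open>
  A closed subscheme \<open>\<Gamma>\<close> of \<open>Proj S\<close> is given by its saturated homogeneous ideal \<open>I\<close>, so that
  \<open>\<Gamma> = Proj (S/I)\<close>.
\<close>

definition homogeneous_ideal :: "('v::finite, 'k::field) mpoly set \<Rightarrow> bool"
  where "homogeneous_ideal I \<longleftrightarrow> ideal I \<S> \<and> (\<forall>p\<in>I. \<forall>e. hcomp e p \<in> I)"

definition saturated :: "('v::finite, 'k::field) mpoly set \<Rightarrow> bool"
  where "saturated I \<longleftrightarrow> (\<forall>p. (\<forall>i. \<exists>k. var i ^ k * p \<in> I) \<longrightarrow> p \<in> I)"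

text \<open>The points of \<open>Proj (S/I)\<close>, as homogeneous primes of \<open>S\<close> containing \<open>I\<close>.\<close>

definition proj :: "('v::finite, 'k::field) mpoly set \<Rightarrow> ('v, 'k) mpoly set set"
  where "proj I = {P. homogeneous_ideal P \<and> primeideal P \<S> \<and> I \<subseteq> P \<and> \<not> range var \<subseteq> P}"

text \<open>
  Chains of irreducible closed subsets correspond to chains of points; the empty scheme has
  dimension \<open>-\<infinity>\<close>.
\<close>

definition proj_dim :: "('v::finite, 'k::field) mpoly set \<Rightarrow> ereal"
  where "proj_dim I =
    (SUP C\<in>{C. C \<subseteq> proj I \<and> finite C \<and> C \<noteq> {} \<and> chain\<^sub>\<subseteq> C}. ereal (real (card C) - 1))"

text \<open>
  The stalk at \<open>P\<close> is the homogeneous localisation \<open>(S/I)\<^sub>(\<^sub>P\<^sub>)\<close>: its elements are classes of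
  fractions \<open>a/f\<close> with \<open>a\<close>, \<open>f\<close> homogeneous of the same degree and \<open>f \<notin> P\<close>, where \<open>a/f = b/g\<close>
  iff \<open>h (a g - b f) = 0\<close> in \<open>S/I\<close> for some homogeneous \<open>h \<notin> P\<close>.
\<close>

definition fractions :: "('v::finite, 'k::field) mpoly set \<Rightarrow> (('v, 'k) mpoly \<times> ('v, 'k) mpoly) set"
  where "fractions P = {(a, f). f \<notin> P \<and> (\<exists>e. homogeneous e a \<and> homogeneous e f)}"

definition fraction_class :: "('v::finite, 'k::field) mpoly set \<Rightarrow> ('v, 'k) mpoly set \<Rightarrow>
    ('v, 'k) mpoly \<Rightarrow> ('v, 'k) mpoly \<Rightarrow> (('v, 'k) mpoly \<times> ('v, 'k) mpoly) set"
  where "fraction_class I P a f =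
    {(b, g) \<in> fractions P. \<exists>h e. homogeneous e h \<and> h \<notin> P \<and> h * (a * g - b * f) \<in> I}"

definition stalk :: "('v::finite, 'k::field) mpoly set \<Rightarrow> ('v, 'k) mpoly set \<Rightarrow>
    (('v, 'k) mpoly \<times> ('v, 'k) mpoly) set set"
  where "stalk I P = {fraction_class I P a f | a f. (a, f) \<in> fractions P}"

definition stalk_add where
  "stalk_add I P x y = (\<Union>(a, f)\<in>x. \<Union>(b, g)\<in>y. fraction_class I P (a * g + b * f) (f * g))"

definition stalk_mult where
  "stalk_mult I P x y = (\<Union>(a, f)\<in>x. \<Union>(b, g)\<in>y. fraction_class I P (a * b) (f * g))"

text \<open>
  Sections over all of \<open>Proj (S/I)\<close> of the structure sheaf: choices of a germ at every point which
  are given by a single fraction on a basic open neighbourhood \<open>{Q. h \<notin> Q}\<close> of each point.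
\<close>

definition sections :: "('v::finite, 'k::field) mpoly set \<Rightarrow>
    (('v, 'k) mpoly set \<Rightarrow> (('v, 'k) mpoly \<times> ('v, 'k) mpoly) set) set"
  where "sections I = {s \<in> (\<Pi>\<^sub>E P\<in>proj I. stalk I P).
    \<forall>P\<in>proj I. \<exists>h e a f. homogeneous e h \<and> h \<notin> P \<and>
      (\<forall>Q\<in>proj I. h \<notin> Q \<longrightarrow> (a, f) \<in> fractions Q \<and> s Q = fraction_class I Q a f)}"

definition const_section where
  "const_section I c = (\<lambda>P\<in>proj I. fraction_class I P (const c) 1)"

definition section_ring :: "('v::finite, 'k::field) mpoly set \<Rightarrow>
    (('v, 'k) mpoly set \<Rightarrow> (('v, 'k) mpoly \<times> ('v, 'k) mpoly) set) ring"
  where "section_ring I =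
    \<lparr> carrier = sections I,
      monoid.mult = (\<lambda>s t. \<lambda>P\<in>proj I. stalk_mult I P (s P) (t P)),
      one = const_section I 1,
      ring.zero = const_section I 0,
      add = (\<lambda>s t. \<lambda>P\<in>proj I. stalk_add I P (s P) (t P)) \<rparr>"

definition has_scheme_degree :: "('v::finite, 'k::field) mpoly set \<Rightarrow> nat \<Rightarrow> bool"
  where "has_scheme_degree I r \<longleftrightarrow>
    ring.dimension (section_ring I) r (range (const_section I)) (carrier (section_ring I))"

definition cactus_rank :: "('v::finite, 'k::field) mpoly \<Rightarrow> nat"
  where "cactus_rank F = (LEAST r. \<exists>I. homogeneous_ideal I \<and> saturated I \<and>
    proj_dim I = 0 \<and> I \<subseteq> annihilator F \<and> has_scheme_degree I r)"

end

theory Submission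
  imports Defs
begin

text \<open>
  Let \<open>I\<close> be the saturated ideal of a zero-dimensional scheme of degree \<open>r\<close> contained in
  \<open>J = F\<^sup>\<bottom>\<close>.  Twists of the structure sheaf are trivial on a zero-dimensional scheme, and forms
  outside \<open>I\<close> have non-zero sections, so the Hilbert function \<open>h\<close> of \<open>S/I\<close> is bounded by \<open>r\<close>.
  The forms of degree \<open>d\<close> in \<open>J\<close> have no common zero, so multiplying \<open>(S/I)\<^sub>e\<close> by them yields a
  subspace of \<open>(J/I)\<^bsub>e+d\<^esub>\<close> of dimension at least \<open>h e\<close>.  Hence \<open>S/J\<close> has dimension at most
  \<open>h (e+d) - h e\<close> in degree \<open>e + d\<close>, and these differences telescope to at most \<open>d r\<close>.
  As the minimum in the cactus rank must be attained, some apolar scheme has to be exhibited: a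
  sufficiently fat point is apolar to every form of a given degree.
\<close>

section \<open>Dimension counts in vector spaces\<close>

text \<open>The ground field is arbitrary, possibly finite, so no form of a prescribed degree need
  avoid all points of the scheme. This shapes both halves of the proof: twists are trivialised
  locally by variables rather than by one linear form, and a whole basis of \<open>J\<close> in
  degree \<open>d\<close> acts as multipliers, one element after another, in place of one general
  form. Forms of degree above that of \<open>F\<close> annihilate \<open>F\<close>, so
  \<open>J\<close> contains a power of every variable. Generators of degree below \<open>d\<close>
  are raised to degree \<open>d\<close> by powers of variables, and saturation removes these again;
  this is why the forms of degree \<open>d\<close> in \<open>J\<close> have no common zero on the
  scheme. The factor \<open>d\<close> arises because the differences of \<open>h\<close> at distance
  \<open>d\<close> collapse to a window of \<open>d\<close> consecutive values of \<open>h\<close>,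
  each at most \<open>r\<close>. Both degrees are defined by the \<open>dimension\<close> of
  HOL-Algebra over a subfield, whereas the counting takes place in \<open>vector_space\<close>.
  Quotients are represented there by pairs of subspaces and all estimates are sums, so that no
  subtraction of naturals occurs.\<close>

context vector_space
begin

text \<open>The span of \<open>B\<close> stands in for the quotient of \<open>Y\<close> by
  \<open>N\<close>, so no quotient space is formed. The polynomial ring is infinite-dimensional, and
  the finite spanning set \<open>T\<close> is what makes \<open>dim\<close> and \<open>card\<close>
  meaningful.\<close>

lemma complement_basis:
  assumes N: "subspace N" and Y: "subspace Y" and NY: "N \<subseteq> Y" and T: "finite T" "Y \<subseteq> span T"
  obtains B where "finite B" "B \<subseteq> Y" "independent B" "card B + dim N = dim Y"
    "span B \<inter> N = {0}" "\<And>y. y \<in> Y \<Longrightarrow> \<exists>b\<in>span B. \<exists>x\<in>N. y = b + x"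
proof -
  obtain A where A: "A \<subseteq> N" "independent A" "N \<subseteq> span A" "card A = dim N"
    using basis_exists by blast
  obtain C where C: "A \<subseteq> C" "C \<subseteq> Y" "independent C" "Y \<subseteq> span C"
    using maximal_independent_subset_extend[of A Y] A NY by blast
  have spA: "span A = N" using A N by (simp add: span_subspace)
  have fC: "finite C" using independent_span_bound[OF T(1) C(3)] C(2) T(2) by blast
  define B where "B = C - A"
  have CAB: "C = A \<union> B" "A \<inter> B = {}" using C(1) B_def by auto
  have fAB: "finite A" "finite B" using fC CAB(1) by auto
  show thesis
  proof
    show "finite B" "B \<subseteq> Y" using fAB C by (auto simp: B_def)
    show "independent B" using C(3) independent_mono B_def by blast
    have "dim Y = card C" using basis_card_eq_dim C by metis
    then show "card B + dim N = dim Y"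
      using A(4) CAB fAB by (simp add: card_Un_disjoint)
    show "span B \<inter> N = {0}"
    proof -
      have "x = 0" if x: "x \<in> span B" "x \<in> span A" for x
      proof -
        \<comment> \<open>Representations are unique: seen through \<open>C\<close>, a common
          element is supported in \<open>B\<close> and in \<open>A\<close>, which are disjoint,
          hence it is zero.\<close>
        have rB: "representation C x = representation B x"
          using representation_extend[OF C(3) x(1)] B_def by auto
        have rA: "representation C x = representation A x"
          using representation_extend[OF C(3) x(2) C(1)] by simp
        have "representation C x v = 0" for v
        proof (rule ccontr)
          assume "representation C x v \<noteq> 0"
          then have "v \<in> A" "v \<in> B"
            using representation_ne_zero[of A x v] representation_ne_zero[of B x v] rA rB by auto
          then show False using CAB by auto
        qed
        moreover have "x = (\<Sum>v | representation C x v \<noteq> 0. scale (representation C x v) v)"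
          using sum_nonzero_representation_eq[OF C(3), of x] span_mono[OF C(1)] x(2) by auto
        ultimately show ?thesis by simp
      qed
      then show ?thesis using spA N subspace_0 span_zero by auto
    qed
    fix y assume "y \<in> Y"
    then have "y \<in> span (A \<union> B)" using C(4) CAB by auto
    then obtain x b where "x \<in> N" "b \<in> span B" "y = b + x"
      unfolding span_Un spA by (auto simp: add.commute)
    then show "\<exists>b\<in>span B. \<exists>x\<in>N. y = b + x" by blast
  qed
qed

lemma independent_Un:
  assumes A: "independent A" and B: "independent B" "finite B" and AB: "span A \<inter> span B = {0}"
  shows "independent (A \<union> B)" "A \<inter> B = {}"
proof -
  have "independent (A \<union> C)" if "C \<subseteq> B" "finite C" for C
    using that(2,1)
  proof induction
    case (insert b C)
    have "b \<notin> span (A \<union> C)"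
    proof
      assume "b \<in> span (A \<union> C)"
      then obtain a c where ac: "a \<in> span A" "c \<in> span C" "b = a + c"
        unfolding span_Un by blast
      have "c \<in> span B" using ac(2) span_mono[of C B] insert.prems by auto
      then have "a \<in> span B"
        using ac(3) insert.prems span_diff[of b B c] span_base[of b B] by auto
      then have "a = 0" using ac(1) AB by blast
      then have "b \<in> span C" using ac by simp
      then have "b \<in> span (B - {b})"
        using span_mono[of C "B - {b}"] insert by auto
      then show False using B(1) insert.prems unfolding dependent_def by auto
    qed
    then show ?case using insert independent_insertI by auto
  qed (simp add: A)
  from this[OF order_refl B(2)] show "independent (A \<union> B)" .
  show "A \<inter> B = {}"
    using A AB span_base[of _ A] span_base[of _ B] dependent_zero[of A] by (metis IntI disjoint_iff singletonD)
qed

lemma card_le_dim: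
  assumes "independent B" "B \<subseteq> W" "finite T" "W \<subseteq> span T"
  shows "finite B" "card B \<le> dim W"
proof -
  obtain C where C: "B \<subseteq> C" "C \<subseteq> W" "independent C" "W \<subseteq> span C"
    using maximal_independent_subset_extend[of B W] assms by blast
  have fC: "finite C" using independent_span_bound[OF assms(3) C(3)] C(2) assms(4) by blast
  then show "finite B" using C finite_subset by blast
  show "card B \<le> dim W" using basis_card_eq_dim[OF C(2,4,3)] fC C(1) card_mono by metis
qed

lemma dim_direct_sum:
  assumes N: "subspace N" and Y: "subspace Y" and Z: "finite T" "N \<subseteq> span T" "Y \<subseteq> span T"
    and NY: "N \<inter> Y = {0}"
  shows "dim {x + y |x y. x \<in> N \<and> y \<in> Y} = dim N + dim Y"
proof -
  obtain A where A: "A \<subseteq> N" "independent A" "N \<subseteq> span A" "card A = dim N"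
    using basis_exists by blast
  obtain B where B: "B \<subseteq> Y" "independent B" "Y \<subseteq> span B" "card B = dim Y"
    using basis_exists by blast
  have sp: "span A = N" "span B = Y" using A B N Y by (simp_all add: span_subspace)
  have fin: "finite A" "finite B" using card_le_dim(1) A B Z by blast+
  have ind: "independent (A \<union> B)" "A \<inter> B = {}"
    using independent_Un[OF A(2) B(2) fin(2)] NY sp by auto
  have "dim (span (A \<union> B)) = card (A \<union> B)" using ind dim_span_eq_card_independent by blast
  then show ?thesis unfolding span_Un sp using A(4) B(4) fin ind(2) by (simp add: card_Un_disjoint)
qed

text \<open>A complement of \<open>N\<close> in \<open>U\<close> is embedded by \<open>f\<close> in
  \<open>W\<close>, and its image meets \<open>Y\<close> only in zero. This compares the quotients
  \<open>U/N\<close> and \<open>W/Y\<close>.\<close>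

lemma dim_le_of_linear_mod:
  assumes U: "subspace U" "N \<subseteq> U" "subspace N" "finite S" "U \<subseteq> span S"
    and W: "subspace W" "Y \<subseteq> W" "subspace Y" "finite T" "W \<subseteq> span T"
    and f: "Vector_Spaces.linear scale scale f" "f ` U \<subseteq> W" "\<And>u. u \<in> U \<Longrightarrow> f u \<in> Y \<Longrightarrow> u \<in> N"
  shows "dim U + dim Y \<le> dim W + dim N"
proof -
  interpret f: Vector_Spaces.linear scale scale f by fact
  interpret pp: vector_space_pair scale scale ..
  obtain B where B: "finite B" "B \<subseteq> U" "independent B" "card B + dim N = dim U" "span B \<inter> N = {0}"
    using complement_basis[OF U(3,1,2) U(4,5)] by metis
  obtain A where A: "A \<subseteq> Y" "independent A" "Y \<subseteq> span A" "card A = dim Y"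
    using basis_exists by blast
  have spA: "span A = Y" using A W by (simp add: span_subspace)
  have BU: "span B \<subseteq> U" using B(2) U(1) span_minimal by blast
  have key: "u = 0" if "u \<in> span B" "f u \<in> Y" for u
    using f(3)[of u] that BU B(5) by auto
  have inj: "inj_on f (span B)"
    using f.inj_on_iff_eq_0[of "span B"] key subspace_0[OF W(3)] by (auto simp: subspace_span)
  have indf: "independent (f ` B)"
    using pp.linear_independent_injective_image[OF f(1) B(3) inj] by simp
  have dj: "y = 0" if "y \<in> span (f ` B)" "y \<in> span A" for y
  proof -
    have "y \<in> f ` span B" using that(1) by (simp only: f.span_image)
    then obtain u where "u \<in> span B" "y = f u" by auto
    then show ?thesis using key[of u] that(2) spA f.zero by simp
  qed
  have AW: "A \<subseteq> W" using A(1) W(2) by blast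
  have ind: "independent (A \<union> f ` B)" "A \<inter> f ` B = {}"
    using independent_Un[OF A(2) indf finite_imageI[OF B(1)]] dj span_zero by auto
  have "finite A" using card_le_dim(1)[OF A(2) AW W(4,5)] .
  then have "dim Y + card (f ` B) = card (A \<union> f ` B)"
    using A(4) B(1) ind(2) by (simp add: card_Un_disjoint)
  also have "\<dots> \<le> dim W"
    using card_le_dim(2)[OF ind(1) _ W(4,5)] AW B(2) f(2) by blast
  also have "card (f ` B) = card B"
    using inj span_superset by (intro card_image) (rule inj_on_subset)
  finally show ?thesis using B(4) by simp
qed

end

section \<open>Homogeneous polynomials and ideals\<close>

lemma mdeg_add [simp]: "mdeg (\<alpha> + \<beta>) = mdeg \<alpha> + mdeg \<beta>"
  by (simp add: mdeg_def lookup_add sum.distrib)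

lemma mdeg_zero [simp]: "mdeg 0 = 0"
  by (simp add: mdeg_def)

lemma mdeg_single [simp]: "mdeg (Poly_Mapping.single i k) = k"
proof -
  have "mdeg (Poly_Mapping.single i k) = (\<Sum>j\<in>UNIV. if j = i then k else 0)"
    unfolding mdeg_def lookup_single when_def by (rule sum.cong) auto
  then show ?thesis by simp
qed

lemma finite_mdeg_le: "finite {\<alpha> :: 'v::finite \<Rightarrow>\<^sub>0 nat. mdeg \<alpha> \<le> M}"
proof (rule finite_imageD)
  show "finite (Poly_Mapping.lookup ` {\<alpha> :: 'v \<Rightarrow>\<^sub>0 nat. mdeg \<alpha> \<le> M})"
  proof (rule finite_subset)
    show "Poly_Mapping.lookup ` {\<alpha> :: 'v \<Rightarrow>\<^sub>0 nat. mdeg \<alpha> \<le> M} \<subseteq> UNIV \<rightarrow>\<^sub>E {..M}"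
    proof (intro image_subsetI PiE_I)
      fix \<alpha> :: "'v \<Rightarrow>\<^sub>0 nat" and i assume "\<alpha> \<in> {\<alpha>. mdeg \<alpha> \<le> M}"
      then show "Poly_Mapping.lookup \<alpha> i \<in> {..M}"
        unfolding mdeg_def
        using member_le_sum[of i UNIV "Poly_Mapping.lookup \<alpha>"] by simp
    qed simp
  qed (simp add: finite_PiE)
  show "inj_on Poly_Mapping.lookup {\<alpha> :: 'v \<Rightarrow>\<^sub>0 nat. mdeg \<alpha> \<le> M}"
    by (simp add: inj_on_def lookup_inject)
qed

lemma const_simps [simp]:
  "const 0 = 0" "const 1 = 1" "const (a + b) = const a + const b" "const (a * b) = const a * const b"
  by (simp_all add: const_def single_add mult_single)

lemma const_uminus [simp]: "const (- a) = - const a"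
  by (simp add: const_def single_uminus)

lemma const_power: "const (a ^ n) = const a ^ n"
  by (induction n) simp_all

lemma const_inverse [simp]: "c \<noteq> 0 \<Longrightarrow> const (inverse c) * const c = 1"
  unfolding const_simps(4)[symmetric] by simp

lemma single_eq_const_mult: "Poly_Mapping.single \<alpha> c = const c * Poly_Mapping.single \<alpha> 1"
  by (simp add: const_def mult_single)

text \<open>Scalars act through constant polynomials, so ideals become subspaces and the counts
  above apply to their graded pieces.\<close>

global_interpretation mp: vector_space "\<lambda>(c::'k::field) (p::('v, 'k) mpoly). const c * p"
  by unfold_locales (simp_all add: algebra_simps)

lemma homogeneous_lookup: "homogeneous e p \<longleftrightarrow> (\<forall>\<alpha>. mdeg \<alpha> \<noteq> e \<longrightarrow> Poly_Mapping.lookup p \<alpha> = 0)"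
  unfolding homogeneous_def by (auto simp: in_keys_iff)

lemma homogeneous_zero [simp, intro]: "homogeneous e 0"
  by (simp add: homogeneous_def)

lemma homogeneous_add [intro]: "homogeneous e p \<Longrightarrow> homogeneous e q \<Longrightarrow> homogeneous e (p + q)"
  by (simp add: homogeneous_lookup lookup_add)

lemma homogeneous_diff [intro]: "homogeneous e p \<Longrightarrow> homogeneous e q \<Longrightarrow> homogeneous e (p - q)"
  by (simp add: homogeneous_lookup lookup_minus)

lemma homogeneous_sum: "(\<And>x. x \<in> A \<Longrightarrow> homogeneous e (f x)) \<Longrightarrow> homogeneous e (\<Sum>x\<in>A. f x)"
  by (simp add: homogeneous_lookup lookup_sum)

lemma homogeneous_single [simp]: "homogeneous (mdeg \<alpha>) (Poly_Mapping.single \<alpha> c)"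
  by (auto simp: homogeneous_lookup lookup_single when_def)

lemma homogeneous_const [simp, intro]: "homogeneous 0 (const c)"
  unfolding const_def using homogeneous_single[of 0 c] by simp

lemma homogeneous_one [simp, intro]: "homogeneous 0 1"
  using homogeneous_const[of 1] by simp

lemma homogeneous_var [simp, intro]: "homogeneous 1 (var i)"
  unfolding var_def by (metis homogeneous_single mdeg_single)

lemma homogeneous_mult [intro]:
  assumes "homogeneous a p" "homogeneous b q" shows "homogeneous (a + b) (p * q)"
  unfolding homogeneous_def
proof
  fix \<alpha> assume "\<alpha> \<in> Poly_Mapping.keys (p * q)"
  then obtain \<beta> \<gamma> where "\<beta> \<in> Poly_Mapping.keys p" "\<gamma> \<in> Poly_Mapping.keys q" "\<alpha> = \<beta> + \<gamma>"
    using keys_mult[of p q] by auto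
  then show "mdeg \<alpha> = a + b" using assms by (simp add: homogeneous_def)
qed

lemma homogeneous_scale: "homogeneous e p \<Longrightarrow> homogeneous e (const c * p)"
  using homogeneous_mult[of 0 "const c" e p] by auto

lemma homogeneous_power: "homogeneous a p \<Longrightarrow> homogeneous (n * a) (p ^ n)"
  by (induction n) auto

lemma homogeneous_var_power [simp, intro]: "homogeneous e (var i ^ e)"
  using homogeneous_power[OF homogeneous_var, of e i] by simp

lemma homogeneous_prod:
  "(\<And>x. x \<in> A \<Longrightarrow> \<exists>e. homogeneous e (f x)) \<Longrightarrow> \<exists>e. homogeneous e (\<Prod>x\<in>A. f x)"
proof (induction A rule: infinite_finite_induct)
  case (insert x A)
  then show ?case by (simp, meson homogeneous_mult insertCI)
qed auto

lemma lookup_hcomp: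
  "Poly_Mapping.lookup (hcomp e p) \<alpha> = (if mdeg \<alpha> = e then Poly_Mapping.lookup p \<alpha> else 0)"
proof -
  let ?A = "{\<alpha> \<in> Poly_Mapping.keys p. mdeg \<alpha> = e}"
  have "Poly_Mapping.lookup (hcomp e p) \<alpha> = (\<Sum>\<beta>\<in>?A. if \<beta> = \<alpha> then Poly_Mapping.lookup p \<beta> else 0)"
    unfolding hcomp_def lookup_sum lookup_single when_def by (rule refl)
  also have "\<dots> = (if \<alpha> \<in> ?A then Poly_Mapping.lookup p \<alpha> else 0)"
    by (rule sum.delta) simp
  finally show ?thesis by (auto simp: not_in_keys_iff_lookup_eq_zero)
qed

lemma hcomp_zero [simp]: "hcomp e 0 = 0"
  by (rule poly_mapping_eqI) (simp add: lookup_hcomp)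

lemma hcomp_add: "hcomp e (p + q) = hcomp e p + hcomp e q"
  by (rule poly_mapping_eqI) (simp add: lookup_hcomp lookup_add)

lemma homogeneous_hcomp [simp, intro]: "homogeneous e (hcomp e p)"
  by (simp add: homogeneous_lookup lookup_hcomp)

lemma hcomp_homogeneous: "homogeneous d p \<Longrightarrow> hcomp e p = (if d = e then p else 0)"
  by (rule poly_mapping_eqI) (auto simp: lookup_hcomp homogeneous_lookup)

lemma sum_hcomp:
  assumes "\<forall>\<alpha>\<in>Poly_Mapping.keys p. mdeg \<alpha> \<le> M" shows "(\<Sum>e\<le>M. hcomp e p) = p"
  using assms by (intro poly_mapping_eqI) (auto simp: lookup_sum lookup_hcomp in_keys_iff)

lemma ex_degree_bound: "\<exists>M. \<forall>\<alpha>\<in>Poly_Mapping.keys p. mdeg \<alpha> \<le> M"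
  by (rule exI[of _ "Max (mdeg ` Poly_Mapping.keys p)"]) simp

lemma hcomp_mult: "hcomp e (p * q) = (\<Sum>k\<le>e. hcomp k p * hcomp (e - k) q)"
proof (induction p rule: mpoly_induct)
  case (2 \<alpha> c)
  show ?case
  proof (induction q rule: mpoly_induct)
    case (2 \<beta> d)
    have "(\<Sum>k\<le>e. hcomp k (Poly_Mapping.single \<alpha> c) * hcomp (e - k) (Poly_Mapping.single \<beta> d)) =
      (\<Sum>k\<le>e. if k = mdeg \<alpha> then (if mdeg \<alpha> + mdeg \<beta> = e then Poly_Mapping.single (\<alpha> + \<beta>) (c * d) else 0) else 0)"
      by (intro sum.cong) (auto simp: hcomp_homogeneous[OF homogeneous_single] mult_single)
    also have "\<dots> = hcomp e (Poly_Mapping.single \<alpha> c * Poly_Mapping.single \<beta> d)"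
      using hcomp_homogeneous[OF homogeneous_single, of e "\<alpha> + \<beta>" "c * d"] by (auto simp: mult_single)
    finally show ?case by simp
  qed (simp_all add: hcomp_add algebra_simps sum.distrib)
qed (simp_all add: hcomp_add algebra_simps sum.distrib)

lemma hcomp_mult_homogeneous:
  assumes "homogeneous d q" shows "hcomp e (p * q) = (if d \<le> e then hcomp (e - d) p * q else 0)"
proof -
  have "hcomp e (p * q) = (\<Sum>k\<le>e. if k = e - d then (if d \<le> e then hcomp (e - d) p * q else 0) else 0)"
    unfolding hcomp_mult by (intro sum.cong) (auto simp: hcomp_homogeneous[OF assms])
  then show ?thesis by simp
qed

section \<open>Ideals of the polynomial ring in elementary terms\<close>

lemma carrier_poly_ring [simp]: "carrier \<S> = UNIV"
  and mult_poly_ring [simp]: "x \<otimes>\<^bsub>\<S>\<^esub> y = x * y"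
  and add_poly_ring [simp]: "x \<oplus>\<^bsub>\<S>\<^esub> y = x + y"
  and zero_poly_ring [simp]: "\<zero>\<^bsub>\<S>\<^esub> = 0"
  and one_poly_ring [simp]: "\<one>\<^bsub>\<S>\<^esub> = 1"
  by (simp_all add: ring_of_type_algebra_def)

lemma ring_poly_ring: "ring (\<S> :: ('v, 'k::field) mpoly ring)"
  by (rule ring_from_type_algebra)

lemma cring_poly_ring: "cring (\<S> :: ('v, 'k::field) mpoly ring)"
  by (rule cring_from_type_algebra)

lemma ideal_poly_ring_iff:
  fixes I :: "('v, 'k::field) mpoly set"
  shows "ideal I \<S> \<longleftrightarrow> 0 \<in> I \<and> (\<forall>p\<in>I. \<forall>q\<in>I. p + q \<in> I) \<and> (\<forall>p\<in>I. \<forall>r. r * p \<in> I)"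
proof
  assume "ideal I \<S>"
  then interpret ideal I \<S> .
  show "0 \<in> I \<and> (\<forall>p\<in>I. \<forall>q\<in>I. p + q \<in> I) \<and> (\<forall>p\<in>I. \<forall>r. r * p \<in> I)"
    using additive_subgroup.zero_closed[OF is_additive_subgroup]
      additive_subgroup.a_closed[OF is_additive_subgroup] I_l_closed by simp
next
  assume *: "0 \<in> I \<and> (\<forall>p\<in>I. \<forall>q\<in>I. p + q \<in> I) \<and> (\<forall>p\<in>I. \<forall>r. r * p \<in> I)"
  interpret cring "\<S> :: ('v, 'k) mpoly ring" by (rule cring_poly_ring)
  show "ideal I \<S>"
  proof (rule idealI[OF ring_poly_ring])
    show "subgroup I (add_monoid \<S>)"
    proof (rule subgroup.intro)
      show "inv\<^bsub>add_monoid \<S>\<^esub> p \<in> I" if "p \<in> I" for p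
      proof -
        have "inv\<^bsub>add_monoid \<S>\<^esub> p = (- 1) * p"
          using minus_equality[of "- p" p] by (simp add: a_inv_def)
        then show ?thesis using * that by metis
      qed
    qed (use * in auto)
  qed (use * in \<open>auto simp: mult.commute\<close>)
qed

lemma homogeneous_ideal_iff:
  "homogeneous_ideal I \<longleftrightarrow> 0 \<in> I \<and> (\<forall>p\<in>I. \<forall>q\<in>I. p + q \<in> I) \<and> (\<forall>p\<in>I. \<forall>r. r * p \<in> I) \<and>
    (\<forall>p\<in>I. \<forall>e. hcomp e p \<in> I)"
  unfolding homogeneous_ideal_def ideal_poly_ring_iff by blast

lemma homogeneous_idealD:
  assumes "homogeneous_ideal I"
  shows "0 \<in> I" "p \<in> I \<Longrightarrow> q \<in> I \<Longrightarrow> p + q \<in> I" "p \<in> I \<Longrightarrow> r * p \<in> I" "p \<in> I \<Longrightarrow> p * r \<in> I"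
    "p \<in> I \<Longrightarrow> q \<in> I \<Longrightarrow> p - q \<in> I" "p \<in> I \<Longrightarrow> hcomp e p \<in> I" "p \<in> I \<Longrightarrow> - p \<in> I"
proof -
  note * = assms[unfolded homogeneous_ideal_iff]
  show "0 \<in> I" "p \<in> I \<Longrightarrow> q \<in> I \<Longrightarrow> p + q \<in> I" "p \<in> I \<Longrightarrow> r * p \<in> I" "p \<in> I \<Longrightarrow> p * r \<in> I"
    "p \<in> I \<Longrightarrow> hcomp e p \<in> I"
    using * by (auto simp: mult.commute)
  have neg: "- q \<in> I" if "q \<in> I" for q
    using * that by (metis mult_minus1)
  show "p \<in> I \<Longrightarrow> - p \<in> I" by (rule neg)
  show "p \<in> I \<Longrightarrow> q \<in> I \<Longrightarrow> p - q \<in> I"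
    using * neg by (metis diff_conv_add_uminus)
qed

lemma homogeneous_ideal_sum:
  assumes "homogeneous_ideal I" "\<And>x. x \<in> A \<Longrightarrow> f x \<in> I" shows "(\<Sum>x\<in>A. f x) \<in> I"
  using assms(2) by (induction A rule: infinite_finite_induct) (auto simp: homogeneous_idealD[OF assms(1)])

lemma homogeneous_ideal_hcompI:
  assumes "homogeneous_ideal I" "\<And>e. hcomp e p \<in> I" shows "p \<in> I"
  using homogeneous_ideal_sum[OF assms(1), of "{.._}" "\<lambda>e. hcomp e p"] assms(2) sum_hcomp[of p]
    ex_degree_bound[of p] by metis

section \<open>Points of projective schemes\<close>

text \<open>The enlarged ideal has to stay homogeneous, since the later Zorn argument for primes
  runs among homogeneous ideals only.\<close>

lemma homogeneous_ideal_adjoin: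
  assumes P: "homogeneous_ideal P" and a: "homogeneous d a"
  shows "homogeneous_ideal {p + r * a |p r. p \<in> P}" (is "homogeneous_ideal ?Q")
  unfolding homogeneous_ideal_iff
proof (intro conjI ballI allI)
  note P = homogeneous_idealD[OF P]
  show "0 \<in> ?Q" using P(1) by (intro CollectI exI[of _ 0]) simp
  fix p assume "p \<in> ?Q"
  then obtain p' r where p: "p' \<in> P" "p = p' + r * a" by blast
  show "p + q \<in> ?Q" if q: "q \<in> ?Q" for q
  proof -
    obtain q' s where "q' \<in> P" "q = q' + s * a" using q by blast
    then show ?thesis using p P(2) by (intro CollectI exI[of _ "p' + q'"] exI[of _ "r + s"]) (simp add: algebra_simps)
  qed
  show "s * p \<in> ?Q" for s
    using p P(3) by (intro CollectI exI[of _ "s * p'"] exI[of _ "s * r"]) (simp add: algebra_simps)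
  show "hcomp e p \<in> ?Q" for e
    using p P(6)[of p' e] hcomp_mult_homogeneous[OF a, of e r]
    by (intro CollectI exI[of _ "hcomp e p'"] exI[of _ "if d \<le> e then hcomp (e - d) r else 0"])
      (simp add: hcomp_add)
qed

text \<open>Compare the components of highest degree outside \<open>P\<close>.\<close>

lemma primeideal_of_homogeneous:
  assumes P: "homogeneous_ideal P" "1 \<notin> P"
    and prime: "\<And>a b d e. homogeneous d a \<Longrightarrow> homogeneous e b \<Longrightarrow> a * b \<in> P \<Longrightarrow> a \<in> P \<or> b \<in> P"
  shows "primeideal P \<S>"
proof (rule primeidealI)
  show "ideal P \<S>" using P by (simp add: homogeneous_ideal_def)
  show "cring \<S>" by (rule cring_poly_ring)
  show "carrier \<S> \<noteq> P" using P(2) by auto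
  have top: "\<exists>i. hcomp i p \<notin> P \<and> (\<forall>k>i. hcomp k p \<in> P)" if p: "p \<notin> P" for p
  proof -
    obtain M where "\<forall>\<alpha>\<in>Poly_Mapping.keys p. mdeg \<alpha> \<le> M" using ex_degree_bound by blast
    then have zero: "hcomp k p = 0" if "k > M" for k
      using that by (intro poly_mapping_eqI) (auto simp: lookup_hcomp simp flip: not_in_keys_iff_lookup_eq_zero)
    have bound: "k \<le> M" if "hcomp k p \<notin> P" for k
      by (rule ccontr) (use that zero[of k] homogeneous_idealD(1)[OF P(1)] in auto)
    obtain k where k: "hcomp k p \<notin> P" using homogeneous_ideal_hcompI[OF P(1)] p by blast
    have "\<exists>i. hcomp i p \<notin> P \<and> (\<forall>k. hcomp k p \<notin> P \<longrightarrow> k \<le> i)"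
      by (rule ex_has_greatest_nat[of "\<lambda>k. hcomp k p \<notin> P" k "\<lambda>k. k" "Suc M"]) (use k bound in \<open>auto simp: less_Suc_eq_le\<close>)
    then show ?thesis using not_le by blast
  qed
  fix a b assume "a \<otimes>\<^bsub>\<S>\<^esub> b \<in> P"
  then have ab: "a * b \<in> P" by simp
  show "a \<in> P \<or> b \<in> P"
  proof (rule ccontr)
    assume "\<not> (a \<in> P \<or> b \<in> P)"
    then have nin: "a \<notin> P" "b \<notin> P" by auto
    obtain i where i: "hcomp i a \<notin> P" "\<forall>k>i. hcomp k a \<in> P" using top[OF nin(1)] by blast
    obtain j where j: "hcomp j b \<notin> P" "\<forall>k>j. hcomp k b \<in> P" using top[OF nin(2)] by blast
    \<comment> \<open>In degree \<open>i + j\<close> every summand but the one at \<open>i\<close>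
      has a factor beyond degree \<open>i\<close> or beyond degree \<open>j\<close>, which lies in
      \<open>P\<close> by the choice of the top components.\<close>
    have "hcomp (i + j) (a * b) = hcomp i a * hcomp j b + (\<Sum>k\<in>{..i+j} - {i}. hcomp k a * hcomp (i + j - k) b)"
      unfolding hcomp_mult by (subst sum.remove[of _ i]) auto
    moreover have "(\<Sum>k\<in>{..i+j} - {i}. hcomp k a * hcomp (i + j - k) b) \<in> P"
    proof (rule homogeneous_ideal_sum[OF P(1)])
      fix k assume "k \<in> {..i+j} - {i}"
      then have "k > i \<or> i + j - k > j" by auto
      then show "hcomp k a * hcomp (i + j - k) b \<in> P"
        using i(2) j(2) homogeneous_idealD(3,4)[OF P(1)] by blast
    qed
    moreover have "hcomp (i + j) (a * b) \<in> P" using homogeneous_idealD(6)[OF P(1) ab] .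
    ultimately have "hcomp i a * hcomp j b \<in> P"
      using homogeneous_idealD(5)[OF P(1), of "hcomp (i + j) (a * b)"] by fastforce
    then show False using prime[OF homogeneous_hcomp homogeneous_hcomp] i(1) j(1) by blast
  qed
qed

text \<open>Krull's construction of a prime in graded form: maximality is taken among homogeneous
  ideals avoiding \<open>M\<close>, and primality is then tested on homogeneous elements. It
  supplies points of \<open>proj I\<close> with prescribed vanishing.\<close>

lemma homogeneous_prime_avoiding:
  assumes J: "homogeneous_ideal J" and one: "1 \<in> M" and mult: "\<And>a b. a \<in> M \<Longrightarrow> b \<in> M \<Longrightarrow> a * b \<in> M"
    and JM: "J \<inter> M = {}"
  obtains P where "homogeneous_ideal P" "primeideal P \<S>" "J \<subseteq> P" "P \<inter> M = {}"
proof -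
  define \<A> where "\<A> = {P. homogeneous_ideal P \<and> J \<subseteq> P \<and> P \<inter> M = {}}"
  have "\<exists>P\<in>\<A>. \<forall>Q\<in>\<A>. P \<subseteq> Q \<longrightarrow> Q = P"
  proof (rule subset_Zorn_nonempty)
    show "\<A> \<noteq> {}" using J JM by (auto simp: \<A>_def)
    fix C assume C: "C \<noteq> {}" "subset.chain \<A> C"
    then have el: "homogeneous_ideal P" "J \<subseteq> P" "P \<inter> M = {}" if "P \<in> C" for P
      using that by (auto simp: subset_chain_def \<A>_def)
    have "homogeneous_ideal (\<Union>C)"
      unfolding homogeneous_ideal_iff
    proof (intro conjI ballI allI)
      show "0 \<in> \<Union>C" using C el homogeneous_idealD(1) by blast
      fix p assume "p \<in> \<Union>C"
      then obtain P where P: "P \<in> C" "p \<in> P" by blast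
      show "p + q \<in> \<Union>C" if q: "q \<in> \<Union>C" for q
      proof -
        obtain Q where Q: "Q \<in> C" "q \<in> Q" using q by blast
        then have "P \<subseteq> Q \<or> Q \<subseteq> P" using C P unfolding subset_chain_def by blast
        then show ?thesis using P Q el(1) homogeneous_idealD(2) by blast
      qed
      show "r * p \<in> \<Union>C" for r using P el(1) homogeneous_idealD(3) by blast
      show "hcomp e p \<in> \<Union>C" for e using P el(1) homogeneous_idealD(6) by blast
    qed
    moreover have "J \<subseteq> \<Union>C" using C(1) el(2) by blast
    moreover have "\<Union>C \<inter> M = {}" using el(3) by blast
    ultimately show "\<Union>C \<in> \<A>" by (simp add: \<A>_def)
  qed
  then obtain P where PA: "P \<in> \<A>" and maxA: "\<forall>Q\<in>\<A>. P \<subseteq> Q \<longrightarrow> Q = P" by (rule bexE)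
  from PA have P: "homogeneous_ideal P" "J \<subseteq> P" "P \<inter> M = {}" by (simp_all add: \<A>_def)
  have max: "Q = P" if "homogeneous_ideal Q" "P \<subseteq> Q" "Q \<inter> M = {}" for Q
    using maxA that P(2) by (simp add: \<A>_def)
  note PD = homogeneous_idealD[OF P(1)]
  \<comment> \<open>By maximality, adjoining a form outside \<open>P\<close> makes the ideal meet
    \<open>M\<close>. If a product of two such forms lay in \<open>P\<close>, the product of the two
    meeting elements would lie in both \<open>P\<close> and \<open>M\<close>.\<close>
  have meets: "\<exists>p\<in>P. \<exists>r. p + r * a \<in> M" if a: "homogeneous d a" "a \<notin> P" for d a
  proof (rule ccontr)
    assume no: "\<not> ?thesis"
    let ?Q = "{p + r * a |p r. p \<in> P}"
    have "P \<subseteq> ?Q" by (force intro: exI[of _ 0])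
    moreover have "?Q \<inter> M = {}" using no by blast
    ultimately have "?Q = P" using max homogeneous_ideal_adjoin[OF P(1) a(1)] by blast
    moreover have "a \<in> ?Q" using PD(1) by (intro CollectI exI[of _ 0] exI[of _ 1]) simp
    ultimately show False using a(2) by blast
  qed
  have "primeideal P \<S>"
  proof (rule primeideal_of_homogeneous[OF P(1)])
    show "1 \<notin> P" using one P(3) by blast
    fix a b d e assume ab: "homogeneous d a" "homogeneous e b" "a * b \<in> P"
    show "a \<in> P \<or> b \<in> P"
    proof (rule ccontr)
      assume "\<not> (a \<in> P \<or> b \<in> P)"
      then have nin: "a \<notin> P" "b \<notin> P" by auto
      obtain p r where pr: "p \<in> P" "p + r * a \<in> M" using meets[OF ab(1) nin(1)] by blast
      obtain q s where qs: "q \<in> P" "q + s * b \<in> M" using meets[OF ab(2) nin(2)] by blast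
      note * = pr qs
      have "(p + r * a) * (q + s * b) = (q + s * b) * p + (r * a) * q + (r * s) * (a * b)"
        by (simp add: algebra_simps)
      also have "\<dots> \<in> P" using * ab PD(2,3) by blast
      finally show False using mult[OF *(2,4)] P(3) by blast
    qed
  qed
  then show thesis using that P by blast
qed

section \<open>Points, local vanishing and schemes of dimension zero\<close>

lemma projI:
  assumes "homogeneous_ideal P" "primeideal P \<S>" "I \<subseteq> P" "var i \<notin> P"
  shows "P \<in> proj I"
  unfolding proj_def using assms by blast

lemma projD:
  assumes "P \<in> proj I"
  shows "homogeneous_ideal P" "primeideal P \<S>" "I \<subseteq> P" "\<exists>i. var i \<notin> P" "1 \<notin> P"
    "a * b \<in> P \<longleftrightarrow> a \<in> P \<or> b \<in> P"
proof -
  show *: "homogeneous_ideal P" "primeideal P \<S>" "I \<subseteq> P" "\<exists>i. var i \<notin> P"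
    using assms by (auto simp: proj_def)
  show "1 \<notin> P"
  proof
    assume "1 \<in> P"
    then have "P = UNIV" using homogeneous_idealD(3)[OF *(1), of 1] by auto
    then show False using primeideal.I_notcarr[OF *(2)] by simp
  qed
  show "a * b \<in> P \<longleftrightarrow> a \<in> P \<or> b \<in> P"
    using primeideal.I_prime[OF *(2), of a b] homogeneous_idealD(3,4)[OF *(1)] by auto
qed

lemma proj_power_notin:
  assumes "P \<in> proj I" "f \<notin> P" shows "f ^ n \<notin> P"
  using assms(2) by (induction n) (simp_all add: projD(5,6)[OF assms(1)])

lemma proj_prod_notin:
  assumes "P \<in> proj I" "\<And>x. x \<in> A \<Longrightarrow> f x \<notin> P" shows "(\<Prod>x\<in>A. f x) \<notin> P"
  using assms(2) by (induction A rule: infinite_finite_induct) (simp_all add: projD(5,6)[OF assms(1)])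

lemma homogeneous_ideal_colon:
  assumes I: "homogeneous_ideal I" and a: "homogeneous d a"
  shows "homogeneous_ideal {p. p * a \<in> I}"
  unfolding homogeneous_ideal_iff
proof (intro conjI ballI allI)
  note ID = homogeneous_idealD[OF I]
  show "0 \<in> {p. p * a \<in> I}" using ID(1) by simp
  fix p assume p: "p \<in> {p. p * a \<in> I}"
  show "p + q \<in> {p. p * a \<in> I}" if "q \<in> {p. p * a \<in> I}" for q
    using p that ID(2) by (simp add: distrib_right)
  show "r * p \<in> {p. p * a \<in> I}" for r using p ID(3) by (simp add: mult.assoc)
  show "hcomp e p \<in> {p. p * a \<in> I}" for e
    using ID(6)[of "p * a" "e + d"] p by (simp add: hcomp_mult_homogeneous[OF a])
qed

text \<open>A form outside \<open>I\<close> has, by saturation, a variable none of whose powers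
  multiplies it into \<open>I\<close>. A prime that contains the colon ideal and avoids those powers
  is a point at which the form is not locally zero.\<close>

lemma saturated_memI:
  assumes I: "homogeneous_ideal I" "saturated I" and a: "homogeneous d a"
    and loc: "\<And>P. P \<in> proj I \<Longrightarrow> \<exists>h. h \<notin> P \<and> h * a \<in> I"
  shows "a \<in> I"
proof (rule ccontr)
  assume "a \<notin> I"
  then obtain i where i: "\<And>k. var i ^ k * a \<notin> I" using I(2) unfolding saturated_def by blast
  let ?J = "{p. p * a \<in> I}" and ?M = "range (\<lambda>k. var i ^ k)"
  obtain P where P: "homogeneous_ideal P" "primeideal P \<S>" "?J \<subseteq> P" "P \<inter> ?M = {}"
  proof (rule homogeneous_prime_avoiding[of ?J ?M])
    show "homogeneous_ideal ?J" by (rule homogeneous_ideal_colon[OF I(1) a])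
    show "1 \<in> ?M" by (rule range_eqI[of _ _ 0]) simp
    show "p * q \<in> ?M" if "p \<in> ?M" "q \<in> ?M" for p q
      using that by (auto simp flip: power_add)
    show "?J \<inter> ?M = {}" using i by auto
  qed
  have "var i \<notin> P" using P(4) rangeI[of "\<lambda>k. var i ^ k" 1] by auto
  moreover have "I \<subseteq> P" using P(3) homogeneous_idealD(4)[OF I(1)] by blast
  ultimately have "P \<in> proj I" using P by (blast intro: projI)
  then show False using loc P(3) by blast
qed

lemma proj_dim_zeroD:
  assumes "proj_dim I = 0"
  shows "proj I \<noteq> {}" "P \<in> proj I \<Longrightarrow> Q \<in> proj I \<Longrightarrow> P \<subseteq> Q \<Longrightarrow> P = Q"
proof -
  let ?\<C> = "{C. C \<subseteq> proj I \<and> finite C \<and> C \<noteq> {} \<and> chain\<^sub>\<subseteq> C}"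
  show "proj I \<noteq> {}"
  proof
    assume "proj I = {}"
    then have *: "?\<C> = {}" by auto
    have "proj_dim I = - \<infinity>" unfolding proj_dim_def * by (simp add: bot_ereal_def)
    then show False using assms by simp
  qed
  assume PQ: "P \<in> proj I" "Q \<in> proj I" "P \<subseteq> Q"
  show "P = Q"
  proof (rule ccontr)
    assume ne: "P \<noteq> Q"
    have "{P, Q} \<in> ?\<C>" using PQ by (auto simp: chain_subset_def)
    then have "ereal (real (card {P, Q}) - 1) \<le> proj_dim I"
      unfolding proj_dim_def by (rule SUP_upper)
    then show False using assms ne by simp
  qed
qed

lemma proj_dim_singleton:
  assumes "proj I = {P}" shows "proj_dim I = 0"
proof -
  have "{C. C \<subseteq> proj I \<and> finite C \<and> C \<noteq> {} \<and> chain\<^sub>\<subseteq> C} = {{P}}"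
    using assms by (auto simp: chain_subset_def)
  then show ?thesis by (simp add: proj_dim_def)
qed

text \<open>In a zero-dimensional scheme the local rings are zero-dimensional, so a non-unit is nilpotent there.\<close>

lemma proj_dim_zero_nilpotent:
  assumes I: "homogeneous_ideal I" "proj_dim I = 0" and P: "P \<in> proj I" and h: "homogeneous d h" "h \<in> P"
  obtains g e N where "homogeneous e g" "g \<notin> P" "g * h ^ N \<in> I"
proof (rule ccontr)
  note PD = projD[OF P]
  assume "\<not> thesis"
  with that have no: "\<And>e g N. homogeneous e g \<Longrightarrow> g \<notin> P \<Longrightarrow> g * h ^ N \<notin> I" by blast
  \<comment> \<open>The multiplicative set generated by \<open>h\<close> and the forms outside
    \<open>P\<close>. A prime avoiding it lies in \<open>P\<close> and omits \<open>h\<close>, so it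
    would be a point strictly below \<open>P\<close>.\<close>
  let ?M = "{g * h ^ N |g N. g \<notin> P \<and> (\<exists>e. homogeneous e g)}"
  obtain Q where Q: "homogeneous_ideal Q" "primeideal Q \<S>" "I \<subseteq> Q" "Q \<inter> ?M = {}"
  proof (rule homogeneous_prime_avoiding[of I ?M])
    show "homogeneous_ideal I" by fact
    show "1 \<in> ?M" using PD(5) by (intro CollectI exI[of _ 1] exI[of _ 0]) auto
    show "a * b \<in> ?M" if ab: "a \<in> ?M" "b \<in> ?M" for a b
    proof -
      obtain f M g N where *: "a = f * h ^ M" "f \<notin> P" "\<exists>e. homogeneous e f"
        "b = g * h ^ N" "g \<notin> P" "\<exists>e. homogeneous e g"
        using ab by blast
      then have "f * g \<notin> P" "\<exists>e. homogeneous e (f * g)" using PD(6) by auto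
      then show ?thesis using * 
        by (intro CollectI exI[of _ "f * g"] exI[of _ "M + N"]) (simp add: power_add algebra_simps)
    qed
    show "I \<inter> ?M = {}" using no by blast
  qed
  have "Q \<subseteq> P"
  proof
    fix q assume "q \<in> Q"
    then have "hcomp e q \<in> Q" for e using homogeneous_idealD(6)[OF Q(1)] by blast
    moreover have "hcomp e q \<in> ?M" if "hcomp e q \<notin> P" for e
      using that by (intro CollectI exI[of _ "hcomp e q"] exI[of _ 0]) auto
    ultimately have "hcomp e q \<in> P" for e using Q(4) by blast
    then show "q \<in> P" by (rule homogeneous_ideal_hcompI[OF PD(1)])
  qed
  obtain i where "var i \<notin> P" using PD(4) by blast
  then have "Q \<in> proj I" using Q \<open>Q \<subseteq> P\<close> by (blast intro: projI)
  then have "Q = P" using proj_dim_zeroD(2)[OF I(2) _ P] \<open>Q \<subseteq> P\<close> by blast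
  have "h \<in> ?M" using PD(5) by (intro CollectI exI[of _ 1] exI[of _ 1]) auto
  with Q(4) h(2) show False using \<open>Q = P\<close> by blast
qed

text \<open>A variable vanishing at \<open>P\<close> is locally nilpotent, and the cofactor in that
  relation cuts out a neighbourhood on which it vanishes throughout; a variable not vanishing at
  \<open>P\<close> is its own neighbourhood function. The product of these functions serves all
  variables at once.\<close>

lemma proj_dim_zero_vars_locally_constant:
  assumes I: "homogeneous_ideal I" "proj_dim I = 0" and P: "P \<in> proj I"
  obtains h e where "homogeneous e h" "h \<notin> P"
    "\<And>Q i. Q \<in> proj I \<Longrightarrow> h \<notin> Q \<Longrightarrow> var i \<notin> Q \<longleftrightarrow> var i \<notin> P"
proof -
  have "\<exists>g. (\<exists>e. homogeneous e g) \<and> g \<notin> P \<and> (\<forall>Q\<in>proj I. g \<notin> Q \<longrightarrow> (var i \<notin> Q \<longleftrightarrow> var i \<notin> P))" for i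
  proof (cases "var i \<in> P")
    case True
    obtain g e N where g: "homogeneous e g" "g \<notin> P" "g * var i ^ N \<in> I"
      by (rule proj_dim_zero_nilpotent[OF I P homogeneous_var True])
    have "var i \<in> Q" if "Q \<in> proj I" "g \<notin> Q" for Q
      using g(3) projD(3,6)[OF that(1)] that proj_power_notin by blast
    then show ?thesis using g True by blast
  next
    case False
    then show ?thesis using homogeneous_var by blast
  qed
  then obtain g where g: "\<And>i. \<exists>e. homogeneous e (g i)" "\<And>i. g i \<notin> P"
    "\<And>i Q. Q \<in> proj I \<Longrightarrow> g i \<notin> Q \<Longrightarrow> var i \<notin> Q \<longleftrightarrow> var i \<notin> P"
    by metis
  obtain e where "homogeneous e (\<Prod>i\<in>UNIV. g i)"
    using homogeneous_prod[of UNIV g] g(1) by blast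
  moreover have "(\<Prod>i\<in>UNIV. g i) \<notin> P" by (rule proj_prod_notin[OF P g(2)])
  moreover have "var i \<notin> Q \<longleftrightarrow> var i \<notin> P" if Q: "Q \<in> proj I" "(\<Prod>i\<in>UNIV. g i) \<notin> Q" for i Q
  proof -
    have "(\<Prod>i\<in>UNIV. g i) = g i * (\<Prod>j\<in>UNIV - {i}. g j)" by (rule prod.remove) auto
    then have "g i \<notin> Q" using Q projD(6)[OF Q(1)] by metis
    then show ?thesis using g(3) Q by blast
  qed
  ultimately show thesis using that by blast
qed

section \<open>Sections of the structure sheaf\<close>

lemma fractionsE:
  assumes "(a, f) \<in> fractions P" obtains e where "f \<notin> P" "homogeneous e a" "homogeneous e f"
  using assms by (auto simp: fractions_def)

lemma fractionsI: "f \<notin> P \<Longrightarrow> homogeneous e a \<Longrightarrow> homogeneous e f \<Longrightarrow> (a, f) \<in> fractions P"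
  by (auto simp: fractions_def)

lemma fractions_mult:
  assumes "P \<in> proj I" "(a, f) \<in> fractions P" "(b, g) \<in> fractions P"
  shows "(a * b, f * g) \<in> fractions P"
proof -
  obtain d where d: "f \<notin> P" "homogeneous d a" "homogeneous d f" by (rule fractionsE[OF assms(2)])
  obtain e where e: "g \<notin> P" "homogeneous e b" "homogeneous e g" by (rule fractionsE[OF assms(3)])
  show ?thesis
    using d e projD(6)[OF assms(1)] by (intro fractionsI[of _ _ "d + e"] homogeneous_mult) auto
qed

lemma fractions_add:
  assumes "P \<in> proj I" "(a, f) \<in> fractions P" "(b, g) \<in> fractions P"
  shows "(a * g + b * f, f * g) \<in> fractions P"
proof -
  obtain d where d: "f \<notin> P" "homogeneous d a" "homogeneous d f" by (rule fractionsE[OF assms(2)])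
  obtain e where e: "g \<notin> P" "homogeneous e b" "homogeneous e g" by (rule fractionsE[OF assms(3)])
  have "homogeneous (d + e) (b * f)" using homogeneous_mult[OF e(2) d(3)] by (simp add: add.commute)
  then have "homogeneous (d + e) (a * g + b * f)"
    using homogeneous_mult[OF d(2) e(3)] by (rule homogeneous_add[rotated])
  then show ?thesis
    using d e projD(6)[OF assms(1)] by (intro fractionsI[of _ _ "d + e"] homogeneous_mult) auto
qed

lemma fractions_const: "P \<in> proj I \<Longrightarrow> (const c, 1) \<in> fractions P"
  using projD(5) by (intro fractionsI[of _ _ 0]) auto

lemma mem_fraction_classE:
  assumes "(b, g) \<in> fraction_class I P a f"
  obtains h e where "(b, g) \<in> fractions P" "homogeneous e h" "h \<notin> P" "h * (a * g - b * f) \<in> I"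
  using assms by (auto simp: fraction_class_def)

lemma mem_fraction_classI:
  assumes "(b, g) \<in> fractions P" "homogeneous e h" "h \<notin> P" "h * (a * g - b * f) \<in> I"
  shows "(b, g) \<in> fraction_class I P a f"
  using assms by (auto simp: fraction_class_def)

lemma section_ring_simps:
  "carrier (section_ring I) = sections I"
  "\<one>\<^bsub>section_ring I\<^esub> = const_section I 1"
  "\<zero>\<^bsub>section_ring I\<^esub> = const_section I 0"
  "s \<otimes>\<^bsub>section_ring I\<^esub> t = (\<lambda>P\<in>proj I. stalk_mult I P (s P) (t P))"
  "s \<oplus>\<^bsub>section_ring I\<^esub> t = (\<lambda>P\<in>proj I. stalk_add I P (s P) (t P))"
  by (simp_all add: section_ring_def)

text \<open>Membership of each germ in its stalk follows from the local representation at that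
  point, which leaves two conditions to check.\<close>

lemma sectionsI:
  assumes "\<And>P. P \<notin> proj I \<Longrightarrow> s P = undefined"
    and "\<And>P. P \<in> proj I \<Longrightarrow> \<exists>h e a f. homogeneous e h \<and> h \<notin> P \<and>
      (\<forall>Q\<in>proj I. h \<notin> Q \<longrightarrow> (a, f) \<in> fractions Q \<and> s Q = fraction_class I Q a f)"
  shows "s \<in> sections I"
proof -
  have "s P \<in> stalk I P" if "P \<in> proj I" for P
    using assms(2)[OF that] that unfolding stalk_def by blast
  then have "s \<in> (\<Pi>\<^sub>E P\<in>proj I. stalk I P)" using assms(1) by (auto simp: PiE_def extensional_def)
  then show ?thesis using assms(2) unfolding sections_def by simp
qed

lemma section_rep:
  assumes "s \<in> sections I" "P \<in> proj I"
  obtains a f where "(a, f) \<in> fractions P" "s P = fraction_class I P a f"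
proof -
  have "s P \<in> stalk I P" using assms by (auto simp: sections_def)
  then show thesis using that by (auto simp: stalk_def)
qed

lemma section_local_rep:
  assumes "s \<in> sections I" "P \<in> proj I"
  obtains e h a f where "homogeneous e h" "h \<notin> P"
    "\<forall>Q\<in>proj I. h \<notin> Q \<longrightarrow> (a, f) \<in> fractions Q \<and> s Q = fraction_class I Q a f"
proof -
  have "\<exists>h e a f. homogeneous e h \<and> h \<notin> P \<and>
      (\<forall>Q\<in>proj I. h \<notin> Q \<longrightarrow> (a, f) \<in> fractions Q \<and> s Q = fraction_class I Q a f)"
    using assms unfolding sections_def by simp
  then show thesis by (elim exE conjE) (rule that)
qed

lemma sections_ext:
  assumes "s \<in> sections I" "t \<in> sections I" "\<And>P. P \<in> proj I \<Longrightarrow> s P = t P" shows "s = t"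
  using assms by (intro extensionalityI[of s "proj I" t]) (auto simp: sections_def PiE_def)

lemma const_section_apply: "P \<in> proj I \<Longrightarrow> const_section I c P = fraction_class I P (const c) 1"
  by (simp add: const_section_def)

lemma const_section_mem:
  fixes I :: "('v::finite, 'k::field) mpoly set"
  shows "const_section I c \<in> sections I"
proof (rule sectionsI)
  show "const_section I c P = undefined" if "P \<notin> proj I" for P using that by (simp add: const_section_def)
  fix P assume P: "P \<in> proj I"
  show "\<exists>h e a f. homogeneous e h \<and> h \<notin> P \<and>
      (\<forall>Q\<in>proj I. h \<notin> Q \<longrightarrow> (a, f) \<in> fractions Q \<and> const_section I c Q = fraction_class I Q a f)"
  proof (intro exI conjI ballI impI)
    show "homogeneous 0 (1 :: ('v, 'k) mpoly)" by simp
    show "1 \<notin> P" by (rule projD(5)[OF P])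
    fix Q assume Q: "Q \<in> proj I"
    show "(const c, 1) \<in> fractions Q" by (rule fractions_const[OF Q])
    show "const_section I c Q = fraction_class I Q (const c) 1" by (rule const_section_apply[OF Q])
  qed
qed

lemma section_ring_apply:
  assumes "P \<in> proj I"
  shows "(s \<otimes>\<^bsub>section_ring I\<^esub> t) P = stalk_mult I P (s P) (t P)"
    and "(s \<oplus>\<^bsub>section_ring I\<^esub> t) P = stalk_add I P (s P) (t P)"
  using assms by (simp_all add: section_ring_simps)

section \<open>Independence of representatives and the ring of global sections\<close>

context
  fixes I :: "('v::finite, 'k::field) mpoly set"
  assumes I: "homogeneous_ideal I"
begin

lemma fraction_class_refl:
  assumes "P \<in> proj I" "(a, f) \<in> fractions P" shows "(a, f) \<in> fraction_class I P a f"
  using assms projD(5)[OF assms(1)] homogeneous_idealD(1)[OF I]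
  by (intro mem_fraction_classI[of _ _ _ 0 1]) simp_all

lemma fraction_class_sym:
  assumes "(a, f) \<in> fractions P" "(b, g) \<in> fraction_class I P a f"
  shows "(a, f) \<in> fraction_class I P b g"
proof -
  obtain h e where h: "homogeneous e h" "h \<notin> P" "h * (a * g - b * f) \<in> I"
    by (rule mem_fraction_classE[OF assms(2)])
  have "h * (b * f - a * g) = - (h * (a * g - b * f))" by (simp add: algebra_simps)
  also have "\<dots> \<in> I" using homogeneous_idealD(7)[OF I h(3)] .
  finally show ?thesis using assms(1) h by (intro mem_fraction_classI)
qed

lemma fraction_class_trans:
  assumes P: "P \<in> proj I" and bg: "(b, g) \<in> fraction_class I P a f" and ck: "(c, k) \<in> fraction_class I P b g"
  shows "(c, k) \<in> fraction_class I P a f"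
proof -
  obtain h d where h: "(b, g) \<in> fractions P" "homogeneous d h" "h \<notin> P" "h * (a * g - b * f) \<in> I"
    by (rule mem_fraction_classE[OF bg])
  obtain l e where l: "(c, k) \<in> fractions P" "homogeneous e l" "l \<notin> P" "l * (b * k - c * g) \<in> I"
    by (rule mem_fraction_classE[OF ck])
  obtain n where n: "g \<notin> P" "homogeneous n g" by (rule fractionsE[OF h(1)])
  \<comment> \<open>The denominator \<open>g\<close> of the middle fraction enters the witness,
    since the two relations combine only after multiplication by it.\<close>
  have "h * l * g * (a * k - c * f) = (l * k) * (h * (a * g - b * f)) + (h * f) * (l * (b * k - c * g))"
    by (simp add: algebra_simps)
  also have "\<dots> \<in> I" using h(4) l(4) homogeneous_idealD(2,3)[OF I] by simp
  finally show ?thesis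
    using l(1) h(2,3) l(2,3) n projD(6)[OF P]
    by (intro mem_fraction_classI[of _ _ _ "d + e + n" "h * l * g"] homogeneous_mult) simp_all
qed

lemma fraction_class_eq_iff:
  assumes P: "P \<in> proj I" and af: "(a, f) \<in> fractions P" and bg: "(b, g) \<in> fractions P"
  shows "fraction_class I P a f = fraction_class I P b g \<longleftrightarrow> (b, g) \<in> fraction_class I P a f"
proof
  show "fraction_class I P a f = fraction_class I P b g \<Longrightarrow> (b, g) \<in> fraction_class I P a f"
    using fraction_class_refl[OF P bg] by simp
  assume *: "(b, g) \<in> fraction_class I P a f"
  have **: "(a, f) \<in> fraction_class I P b g" by (rule fraction_class_sym[OF af *])
  show "fraction_class I P a f = fraction_class I P b g"
  proof (intro Set.set_eqI iffI)
    fix x assume x: "x \<in> fraction_class I P a f"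
    show "x \<in> fraction_class I P b g"
      using fraction_class_trans[OF P **, of "fst x" "snd x"] x by simp
  next
    fix x assume x: "x \<in> fraction_class I P b g"
    show "x \<in> fraction_class I P a f"
      using fraction_class_trans[OF P *, of "fst x" "snd x"] x by simp
  qed
qed

lemma fraction_class_eqI:
  assumes P: "P \<in> proj I" and af: "(a, f) \<in> fractions P" and bg: "(b, g) \<in> fractions P" and eq: "a * g = b * f"
  shows "fraction_class I P a f = fraction_class I P b g"
  unfolding fraction_class_eq_iff[OF P af bg]
  using bg eq projD(5)[OF P] homogeneous_idealD(1)[OF I]
  by (intro mem_fraction_classI[of _ _ _ 0 1]) simp_all

text \<open>\<open>stalk_add\<close> unites the classes obtained from all pairs of representatives.
  The union collapses to one class because any two pairs give equivalent fractions.\<close>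

lemma stalk_add_fraction_class:
  assumes P: "P \<in> proj I" and af: "(a, f) \<in> fractions P" and bg: "(b, g) \<in> fractions P"
  shows "stalk_add I P (fraction_class I P a f) (fraction_class I P b g) = fraction_class I P (a * g + b * f) (f * g)"
proof -
  have *: "fraction_class I P (a' * g' + b' * f') (f' * g') = fraction_class I P (a * g + b * f) (f * g)"
    if a': "(a', f') \<in> fraction_class I P a f" and b': "(b', g') \<in> fraction_class I P b g" for a' f' b' g'
  proof -
    obtain h d where h: "(a', f') \<in> fractions P" "homogeneous d h" "h \<notin> P" "h * (a * f' - a' * f) \<in> I"
      by (rule mem_fraction_classE[OF a'])
    obtain l e where l: "(b', g') \<in> fractions P" "homogeneous e l" "l \<notin> P" "l * (b * g' - b' * g) \<in> I"
      by (rule mem_fraction_classE[OF b'])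
    have "h * l * ((a * g + b * f) * (f' * g') - (a' * g' + b' * f') * (f * g)) =
        (l * g * g') * (h * (a * f' - a' * f)) + (h * f * f') * (l * (b * g' - b' * g))"
      by (simp add: algebra_simps)
    also have "\<dots> \<in> I" using h(4) l(4) homogeneous_idealD(2,3)[OF I] by simp
    finally have "(a' * g' + b' * f', f' * g') \<in> fraction_class I P (a * g + b * f) (f * g)"
      using h l projD(6)[OF P]
      by (intro mem_fraction_classI[of _ _ _ "d + e" "h * l"] fractions_add[OF P] homogeneous_mult) simp_all
    then show ?thesis
      using fraction_class_eq_iff[OF P fractions_add[OF P af bg] fractions_add[OF P h(1) l(1)]] by simp
  qed
  show ?thesis
    unfolding stalk_add_def
  proof (intro Set.set_eqI iffI)
    fix x
    assume "x \<in> (\<Union>(a, f)\<in>fraction_class I P a f. \<Union>(b, g)\<in>fraction_class I P b g. fraction_class I P (a * g + b * f) (f * g))"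
    then obtain a' f' b' g' where r: "(a', f') \<in> fraction_class I P a f" "(b', g') \<in> fraction_class I P b g"
      "x \<in> fraction_class I P (a' * g' + b' * f') (f' * g')"
      by auto
    show "x \<in> fraction_class I P (a * g + b * f) (f * g)" using *[OF r(1,2)] r(3) by simp
  next
    fix x assume x: "x \<in> fraction_class I P (a * g + b * f) (f * g)"
    show "x \<in> (\<Union>(a, f)\<in>fraction_class I P a f. \<Union>(b, g)\<in>fraction_class I P b g. fraction_class I P (a * g + b * f) (f * g))"
      by (rule UN_I[OF fraction_class_refl[OF P af]], simp only: prod.case,
        rule UN_I[OF fraction_class_refl[OF P bg]], simp only: prod.case x)
  qed
qed

lemma stalk_mult_fraction_class:
  assumes P: "P \<in> proj I" and af: "(a, f) \<in> fractions P" and bg: "(b, g) \<in> fractions P"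
  shows "stalk_mult I P (fraction_class I P a f) (fraction_class I P b g) = fraction_class I P (a * b) (f * g)"
proof -
  have *: "fraction_class I P (a' * b') (f' * g') = fraction_class I P (a * b) (f * g)"
    if a': "(a', f') \<in> fraction_class I P a f" and b': "(b', g') \<in> fraction_class I P b g" for a' f' b' g'
  proof -
    obtain h d where h: "(a', f') \<in> fractions P" "homogeneous d h" "h \<notin> P" "h * (a * f' - a' * f) \<in> I"
      by (rule mem_fraction_classE[OF a'])
    obtain l e where l: "(b', g') \<in> fractions P" "homogeneous e l" "l \<notin> P" "l * (b * g' - b' * g) \<in> I"
      by (rule mem_fraction_classE[OF b'])
    \<comment> \<open>The mixed product \<open>a' * b * f * g'\<close> is inserted, so that each
      bracket becomes one of the two given relations.\<close>
    have "h * l * ((a * b) * (f' * g') - (a' * b') * (f * g)) =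
        (l * b * g') * (h * (a * f' - a' * f)) + (h * a' * f) * (l * (b * g' - b' * g))"
      by (simp add: algebra_simps)
    also have "\<dots> \<in> I" using h(4) l(4) homogeneous_idealD(2,3)[OF I] by simp
    finally have "(a' * b', f' * g') \<in> fraction_class I P (a * b) (f * g)"
      using h l projD(6)[OF P]
      by (intro mem_fraction_classI[of _ _ _ "d + e" "h * l"] fractions_mult[OF P] homogeneous_mult) simp_all
    then show ?thesis
      using fraction_class_eq_iff[OF P fractions_mult[OF P af bg] fractions_mult[OF P h(1) l(1)]] by simp
  qed
  show ?thesis
    unfolding stalk_mult_def
  proof (intro Set.set_eqI iffI)
    fix x
    assume "x \<in> (\<Union>(a, f)\<in>fraction_class I P a f. \<Union>(b, g)\<in>fraction_class I P b g. fraction_class I P (a * b) (f * g))"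
    then obtain a' f' b' g' where r: "(a', f') \<in> fraction_class I P a f" "(b', g') \<in> fraction_class I P b g"
      "x \<in> fraction_class I P (a' * b') (f' * g')"
      by auto
    show "x \<in> fraction_class I P (a * b) (f * g)" using *[OF r(1,2)] r(3) by simp
  next
    fix x assume x: "x \<in> fraction_class I P (a * b) (f * g)"
    show "x \<in> (\<Union>(a, f)\<in>fraction_class I P a f. \<Union>(b, g)\<in>fraction_class I P b g. fraction_class I P (a * b) (f * g))"
      by (rule UN_I[OF fraction_class_refl[OF P af]], simp only: prod.case,
        rule UN_I[OF fraction_class_refl[OF P bg]], simp only: prod.case x)
  qed
qed

lemma section_mult_mem:
  assumes s: "s \<in> sections I" and t: "t \<in> sections I"
  shows "s \<otimes>\<^bsub>section_ring I\<^esub> t \<in> sections I"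
proof (rule sectionsI)
  show "(s \<otimes>\<^bsub>section_ring I\<^esub> t) P = undefined" if "P \<notin> proj I" for P
    using that by (simp add: section_ring_simps)
  fix P assume P: "P \<in> proj I"
  obtain d h a f where h: "homogeneous d h" "h \<notin> P"
    and hQ: "\<forall>Q\<in>proj I. h \<notin> Q \<longrightarrow> (a, f) \<in> fractions Q \<and> s Q = fraction_class I Q a f"
    by (rule section_local_rep[OF s P])
  obtain e l b g where l: "homogeneous e l" "l \<notin> P"
    and lQ: "\<forall>Q\<in>proj I. l \<notin> Q \<longrightarrow> (b, g) \<in> fractions Q \<and> t Q = fraction_class I Q b g"
    by (rule section_local_rep[OF t P])
  show "\<exists>h e a f. homogeneous e h \<and> h \<notin> P \<and> (\<forall>Q\<in>proj I. h \<notin> Q \<longrightarrow>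
      (a, f) \<in> fractions Q \<and> (s \<otimes>\<^bsub>section_ring I\<^esub> t) Q = fraction_class I Q a f)"
  proof (intro exI conjI ballI impI)
    \<comment> \<open>The product cuts out the intersection of the two neighbourhoods.\<close>
    show "homogeneous (d + e) (h * l)" using h l by (intro homogeneous_mult)
    show "h * l \<notin> P" using h l projD(6)[OF P] by simp
    fix Q assume Q: "Q \<in> proj I" "h * l \<notin> Q"
    then have nin: "h \<notin> Q" "l \<notin> Q" using projD(6)[OF Q(1)] by auto
    have hl: "(a, f) \<in> fractions Q" "s Q = fraction_class I Q a f"
      "(b, g) \<in> fractions Q" "t Q = fraction_class I Q b g"
      using hQ lQ Q(1) nin by simp_all
    show "(a * b, f * g) \<in> fractions Q" using fractions_mult[OF Q(1) hl(1,3)] .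
    show "(s \<otimes>\<^bsub>section_ring I\<^esub> t) Q = fraction_class I Q (a * b) (f * g)"
      using stalk_mult_fraction_class[OF Q(1) hl(1,3)] hl(2,4) Q(1)
      by (simp add: section_ring_simps)
  qed
qed

lemma section_add_mem:
  assumes s: "s \<in> sections I" and t: "t \<in> sections I"
  shows "s \<oplus>\<^bsub>section_ring I\<^esub> t \<in> sections I"
proof (rule sectionsI)
  show "(s \<oplus>\<^bsub>section_ring I\<^esub> t) P = undefined" if "P \<notin> proj I" for P
    using that by (simp add: section_ring_simps)
  fix P assume P: "P \<in> proj I"
  obtain d h a f where h: "homogeneous d h" "h \<notin> P"
    and hQ: "\<forall>Q\<in>proj I. h \<notin> Q \<longrightarrow> (a, f) \<in> fractions Q \<and> s Q = fraction_class I Q a f"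
    by (rule section_local_rep[OF s P])
  obtain e l b g where l: "homogeneous e l" "l \<notin> P"
    and lQ: "\<forall>Q\<in>proj I. l \<notin> Q \<longrightarrow> (b, g) \<in> fractions Q \<and> t Q = fraction_class I Q b g"
    by (rule section_local_rep[OF t P])
  show "\<exists>h e a f. homogeneous e h \<and> h \<notin> P \<and> (\<forall>Q\<in>proj I. h \<notin> Q \<longrightarrow>
      (a, f) \<in> fractions Q \<and> (s \<oplus>\<^bsub>section_ring I\<^esub> t) Q = fraction_class I Q a f)"
  proof (intro exI conjI ballI impI)
    show "homogeneous (d + e) (h * l)" using h l by (intro homogeneous_mult)
    show "h * l \<notin> P" using h l projD(6)[OF P] by simp
    fix Q assume Q: "Q \<in> proj I" "h * l \<notin> Q"
    then have nin: "h \<notin> Q" "l \<notin> Q" using projD(6)[OF Q(1)] by auto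
    have hl: "(a, f) \<in> fractions Q" "s Q = fraction_class I Q a f"
      "(b, g) \<in> fractions Q" "t Q = fraction_class I Q b g"
      using hQ lQ Q(1) nin by simp_all
    show "(a * g + b * f, f * g) \<in> fractions Q" using fractions_add[OF Q(1) hl(1,3)] .
    show "(s \<oplus>\<^bsub>section_ring I\<^esub> t) Q = fraction_class I Q (a * g + b * f) (f * g)"
      using stalk_add_fraction_class[OF Q(1) hl(1,3)] hl(2,4) Q(1)
      by (simp add: section_ring_simps)
  qed
qed

lemma const_section_hom:
  "const_section I (c + c') = const_section I c \<oplus>\<^bsub>section_ring I\<^esub> const_section I c'"
  "const_section I (c * c') = const_section I c \<otimes>\<^bsub>section_ring I\<^esub> const_section I c'"
proof -
  note fc = fractions_const and ca = const_section_apply and mem = const_section_mem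
  show "const_section I (c + c') = const_section I c \<oplus>\<^bsub>section_ring I\<^esub> const_section I c'"
  proof (rule sections_ext[OF mem section_add_mem[OF mem mem]])
    fix P assume P: "P \<in> proj I"
    show "const_section I (c + c') P = (const_section I c \<oplus>\<^bsub>section_ring I\<^esub> const_section I c') P"
      unfolding section_ring_apply[OF P] ca[OF P] stalk_add_fraction_class[OF P fc[OF P] fc[OF P]] by simp
  qed
  show "const_section I (c * c') = const_section I c \<otimes>\<^bsub>section_ring I\<^esub> const_section I c'"
  proof (rule sections_ext[OF mem section_mult_mem[OF mem mem]])
    fix P assume P: "P \<in> proj I"
    show "const_section I (c * c') P = (const_section I c \<otimes>\<^bsub>section_ring I\<^esub> const_section I c') P"
      unfolding section_ring_apply[OF P] ca[OF P] stalk_mult_fraction_class[OF P fc[OF P] fc[OF P]] by simp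
  qed
qed

text \<open>A section is determined by its germs, so the ring laws are checked point by point on
  representing fractions.\<close>

lemma cring_section_ring: "cring (section_ring I)"
proof (rule cringI)
  let ?R = "section_ring I"
  note fm = fractions_mult and fa = fractions_add and fc = fractions_const and ca = const_section_apply
  note ma = stalk_mult_fraction_class and aa = stalk_add_fraction_class and ap = section_ring_apply
  note mem = section_mult_mem section_add_mem const_section_mem
  show "abelian_group ?R"
  proof (rule abelian_groupI; unfold section_ring_simps(1,3))
    show "s \<oplus>\<^bsub>?R\<^esub> t \<in> sections I" if "s \<in> sections I" "t \<in> sections I" for s t
      using that by (rule mem)
    show "const_section I 0 \<in> sections I" by (rule mem)
    show "s \<oplus>\<^bsub>?R\<^esub> t \<oplus>\<^bsub>?R\<^esub> u = s \<oplus>\<^bsub>?R\<^esub> (t \<oplus>\<^bsub>?R\<^esub> u)"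
      if stu: "s \<in> sections I" "t \<in> sections I" "u \<in> sections I" for s t u
    proof (rule sections_ext)
      fix P assume P: "P \<in> proj I"
      obtain a f where s: "(a, f) \<in> fractions P" "s P = fraction_class I P a f" by (rule section_rep[OF stu(1) P])
      obtain b g where t: "(b, g) \<in> fractions P" "t P = fraction_class I P b g" by (rule section_rep[OF stu(2) P])
      obtain c k where u: "(c, k) \<in> fractions P" "u P = fraction_class I P c k" by (rule section_rep[OF stu(3) P])
      show "(s \<oplus>\<^bsub>?R\<^esub> t \<oplus>\<^bsub>?R\<^esub> u) P = (s \<oplus>\<^bsub>?R\<^esub> (t \<oplus>\<^bsub>?R\<^esub> u)) P"
        unfolding ap[OF P] s(2) t(2) u(2) aa[OF P s(1) t(1)] aa[OF P t(1) u(1)]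
          aa[OF P fa[OF P s(1) t(1)] u(1)] aa[OF P s(1) fa[OF P t(1) u(1)]]
        by (rule arg_cong2[where f = "fraction_class I P"]) (simp_all add: algebra_simps)
    qed (use stu in \<open>simp_all add: mem\<close>)
    show "s \<oplus>\<^bsub>?R\<^esub> t = t \<oplus>\<^bsub>?R\<^esub> s" if stu: "s \<in> sections I" "t \<in> sections I" for s t
    proof (rule sections_ext)
      fix P assume P: "P \<in> proj I"
      obtain a f where s: "(a, f) \<in> fractions P" "s P = fraction_class I P a f" by (rule section_rep[OF stu(1) P])
      obtain b g where t: "(b, g) \<in> fractions P" "t P = fraction_class I P b g" by (rule section_rep[OF stu(2) P])
      show "(s \<oplus>\<^bsub>?R\<^esub> t) P = (t \<oplus>\<^bsub>?R\<^esub> s) P"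
        unfolding ap[OF P] s(2) t(2) aa[OF P s(1) t(1)] aa[OF P t(1) s(1)]
        by (rule arg_cong2[where f = "fraction_class I P"]) (simp_all add: algebra_simps)
    qed (use stu in \<open>simp_all add: mem\<close>)
    show "const_section I 0 \<oplus>\<^bsub>?R\<^esub> s = s" if s: "s \<in> sections I" for s
    proof (rule sections_ext)
      fix P assume P: "P \<in> proj I"
      obtain a f where a: "(a, f) \<in> fractions P" "s P = fraction_class I P a f" by (rule section_rep[OF s P])
      show "(const_section I 0 \<oplus>\<^bsub>?R\<^esub> s) P = s P"
        unfolding ap[OF P] ca[OF P] a(2) aa[OF P fc[OF P] a(1)] by simp
    qed (use s in \<open>simp_all add: mem\<close>)
    show "\<exists>t\<in>sections I. t \<oplus>\<^bsub>?R\<^esub> s = const_section I 0" if s: "s \<in> sections I" for s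
    \<comment> \<open>With the multiple by the constant \<open>-1\<close> as additive inverse, its
      local representability is a case of closure under products.\<close>
    proof (rule bexI[of _ "const_section I (- 1) \<otimes>\<^bsub>?R\<^esub> s"])
      show "const_section I (- 1) \<otimes>\<^bsub>?R\<^esub> s \<oplus>\<^bsub>?R\<^esub> s = const_section I 0"
      proof (rule sections_ext)
        fix P assume P: "P \<in> proj I"
        obtain a f where a: "(a, f) \<in> fractions P" "s P = fraction_class I P a f" by (rule section_rep[OF s P])
        note fn = fm[OF P fc[OF P, of "- 1"] a(1)]
        show "(const_section I (- 1) \<otimes>\<^bsub>?R\<^esub> s \<oplus>\<^bsub>?R\<^esub> s) P = const_section I 0 P"
          unfolding ap[OF P] ca[OF P] a(2) ma[OF P fc[OF P] a(1)] aa[OF P fn a(1)]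
          by (rule fraction_class_eqI[OF P fa[OF P fn a(1)] fc[OF P]]) (simp add: algebra_simps)
      qed (use s in \<open>simp_all add: mem\<close>)
    qed (use s in \<open>simp_all add: mem\<close>)
  qed
  show "comm_monoid ?R"
  proof (rule comm_monoidI; unfold section_ring_simps(1,2))
    show "s \<otimes>\<^bsub>?R\<^esub> t \<in> sections I" if "s \<in> sections I" "t \<in> sections I" for s t
      using that by (rule mem)
    show "const_section I 1 \<in> sections I" by (rule mem)
    show "s \<otimes>\<^bsub>?R\<^esub> t \<otimes>\<^bsub>?R\<^esub> u = s \<otimes>\<^bsub>?R\<^esub> (t \<otimes>\<^bsub>?R\<^esub> u)"
      if stu: "s \<in> sections I" "t \<in> sections I" "u \<in> sections I" for s t u
    proof (rule sections_ext)
      fix P assume P: "P \<in> proj I"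
      obtain a f where s: "(a, f) \<in> fractions P" "s P = fraction_class I P a f" by (rule section_rep[OF stu(1) P])
      obtain b g where t: "(b, g) \<in> fractions P" "t P = fraction_class I P b g" by (rule section_rep[OF stu(2) P])
      obtain c k where u: "(c, k) \<in> fractions P" "u P = fraction_class I P c k" by (rule section_rep[OF stu(3) P])
      show "(s \<otimes>\<^bsub>?R\<^esub> t \<otimes>\<^bsub>?R\<^esub> u) P = (s \<otimes>\<^bsub>?R\<^esub> (t \<otimes>\<^bsub>?R\<^esub> u)) P"
        unfolding ap[OF P] s(2) t(2) u(2) ma[OF P s(1) t(1)] ma[OF P t(1) u(1)]
          ma[OF P fm[OF P s(1) t(1)] u(1)] ma[OF P s(1) fm[OF P t(1) u(1)]]
        by (simp add: mult.assoc)
    qed (use stu in \<open>simp_all add: mem\<close>)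
    show "const_section I 1 \<otimes>\<^bsub>?R\<^esub> s = s" if s: "s \<in> sections I" for s
    proof (rule sections_ext)
      fix P assume P: "P \<in> proj I"
      obtain a f where a: "(a, f) \<in> fractions P" "s P = fraction_class I P a f" by (rule section_rep[OF s P])
      show "(const_section I 1 \<otimes>\<^bsub>?R\<^esub> s) P = s P"
        unfolding ap[OF P] ca[OF P] a(2) ma[OF P fc[OF P] a(1)] by simp
    qed (use s in \<open>simp_all add: mem\<close>)
    show "s \<otimes>\<^bsub>?R\<^esub> t = t \<otimes>\<^bsub>?R\<^esub> s" if stu: "s \<in> sections I" "t \<in> sections I" for s t
    proof (rule sections_ext)
      fix P assume P: "P \<in> proj I"
      obtain a f where s: "(a, f) \<in> fractions P" "s P = fraction_class I P a f" by (rule section_rep[OF stu(1) P])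
      obtain b g where t: "(b, g) \<in> fractions P" "t P = fraction_class I P b g" by (rule section_rep[OF stu(2) P])
      show "(s \<otimes>\<^bsub>?R\<^esub> t) P = (t \<otimes>\<^bsub>?R\<^esub> s) P"
        unfolding ap[OF P] s(2) t(2) ma[OF P s(1) t(1)] ma[OF P t(1) s(1)] by (simp add: mult.commute)
    qed (use stu in \<open>simp_all add: mem\<close>)
  qed
  show "(s \<oplus>\<^bsub>?R\<^esub> t) \<otimes>\<^bsub>?R\<^esub> u = s \<otimes>\<^bsub>?R\<^esub> u \<oplus>\<^bsub>?R\<^esub> t \<otimes>\<^bsub>?R\<^esub> u"
    if "s \<in> carrier ?R" "t \<in> carrier ?R" "u \<in> carrier ?R" for s t u
  proof (rule sections_ext)
    have stu: "s \<in> sections I" "t \<in> sections I" "u \<in> sections I" using that by (simp_all add: section_ring_simps)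
    then show "(s \<oplus>\<^bsub>?R\<^esub> t) \<otimes>\<^bsub>?R\<^esub> u \<in> sections I" "s \<otimes>\<^bsub>?R\<^esub> u \<oplus>\<^bsub>?R\<^esub> t \<otimes>\<^bsub>?R\<^esub> u \<in> sections I"
      by (simp_all add: mem)
    fix P assume P: "P \<in> proj I"
    obtain a f where s: "(a, f) \<in> fractions P" "s P = fraction_class I P a f" by (rule section_rep[OF stu(1) P])
    obtain b g where t: "(b, g) \<in> fractions P" "t P = fraction_class I P b g" by (rule section_rep[OF stu(2) P])
    obtain c k where u: "(c, k) \<in> fractions P" "u P = fraction_class I P c k" by (rule section_rep[OF stu(3) P])
    note fadd = fa[OF P s(1) t(1)] and fsu = fm[OF P s(1) u(1)] and ftu = fm[OF P t(1) u(1)]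
    \<comment> \<open>The fraction on the right is the one on the left expanded by \<open>k\<close>,
      so the two pairs differ and only their classes agree.\<close>
    show "((s \<oplus>\<^bsub>?R\<^esub> t) \<otimes>\<^bsub>?R\<^esub> u) P = (s \<otimes>\<^bsub>?R\<^esub> u \<oplus>\<^bsub>?R\<^esub> t \<otimes>\<^bsub>?R\<^esub> u) P"
      unfolding ap[OF P] s(2) t(2) u(2) aa[OF P s(1) t(1)] ma[OF P fadd u(1)] ma[OF P s(1) u(1)] ma[OF P t(1) u(1)] aa[OF P fsu ftu]
      by (rule fraction_class_eqI[OF P fm[OF P fadd u(1)] fa[OF P fsu ftu]]) (simp add: algebra_simps)
  qed
qed

end

section \<open>Hilbert function and scheme degree\<close>

text \<open>HOL-Algebra takes scalars from a subfield of the ring itself. The image of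
  \<open>K\<close> under the constants is one as soon as the ring is not zero.\<close>

lemma subfield_range_hom:
  fixes R (structure) and \<kappa> :: "'k::field \<Rightarrow> 'a"
  assumes R: "ring R" and \<kappa>: "\<And>c. \<kappa> c \<in> carrier R" "\<And>c c'. \<kappa> (c + c') = \<kappa> c \<oplus> \<kappa> c'"
    "\<And>c c'. \<kappa> (c * c') = \<kappa> c \<otimes> \<kappa> c'" "\<kappa> 1 = \<one>" and nz: "\<one> \<noteq> \<zero>"
  shows "subfield (range \<kappa>) R"
proof -
  let ?K = "ring_of_type_algebra :: 'k ring"
  have K: "field ?K" by (rule field_from_type_algebra)
  have "ring_hom_ring ?K R \<kappa>"
    by (rule ring_hom_ringI[OF ring_from_type_algebra R]) (simp_all add: ring_of_type_algebra_def \<kappa>)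
  from ring_hom_ring.img_is_subfield(2)[OF this field.carrier_is_subfield[OF K] nz]
  show ?thesis by (simp add: ring_of_type_algebra_def)
qed

text \<open>Bridge between the two notions of dimension: \<open>ring.dimension\<close> grows by one
  line at a time, which matches an induction over the basis. Linearity of \<open>\<phi>\<close> is
  asked only on \<open>V\<close>, because twisted sections are shown to be additive for forms of one
  fixed degree.\<close>

lemma (in vector_space) dimension_image_span:
  fixes R (structure)
  assumes R: "ring R" and V: "subspace V" and B: "finite B" "independent B" "B \<subseteq> V"
    and \<phi>: "\<And>x. x \<in> V \<Longrightarrow> \<phi> x \<in> carrier R" "\<And>x y. x \<in> V \<Longrightarrow> y \<in> V \<Longrightarrow> \<phi> (x + y) = \<phi> x \<oplus> \<phi> y"
      "\<And>c x. x \<in> V \<Longrightarrow> \<phi> (scale c x) = \<kappa> c \<otimes> \<phi> x"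
    and inj: "\<And>x. x \<in> span B \<Longrightarrow> \<phi> x = \<zero> \<Longrightarrow> x = 0"
  shows "ring.dimension R (card B) (range \<kappa>) (\<phi> ` span B)"
proof -
  interpret R: ring R by fact
  show ?thesis
    using B inj
  proof (induction B)
    case empty
    have "\<phi> 0 \<oplus> \<phi> 0 = \<phi> 0" using \<phi>(2)[of 0 0] subspace_0[OF V] by simp
    then have "\<phi> 0 = \<zero>" using \<phi>(1)[OF subspace_0[OF V]] R.add.r_cancel_one[of "\<phi> 0" "\<phi> 0"] by simp
    then show ?case using R.zero_dim by simp
  next
    case (insert b B)
    have ins: "span (insert b B) \<subseteq> V" using insert.prems(2) V span_minimal by blast
    have sub: "span B \<subseteq> span (insert b B)" by (rule span_mono) blast
    have V': "x \<in> V" if "x \<in> span B" for x using that ins sub by blast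
    have b: "b \<in> span (insert b B)" "b \<in> V" using insert.prems(2) span_base by auto
    have bB: "b \<notin> span B" using insert.prems(1) insert.hyps unfolding dependent_def by auto
    have ind: "independent B" using insert.prems(1) independent_mono by blast
    have IH: "R.dimension (card B) (range \<kappa>) (\<phi> ` span B)"
      using insert.IH ind insert.prems sub by blast
    have "\<phi> b \<notin> \<phi> ` span B"
    proof
      assume "\<phi> b \<in> \<phi> ` span B"
      then obtain x where x: "x \<in> span B" "\<phi> b = \<phi> x" by blast
      have bx: "b - x \<in> span (insert b B)" using b(1) x(1) sub span_diff by blast
      have "\<phi> (b - x) \<oplus> \<phi> x = \<phi> x" using \<phi>(2)[of "b - x" x] bx ins V'[OF x(1)] x(2) by auto
      moreover have "\<phi> (b - x) \<in> carrier R" "\<phi> x \<in> carrier R" using \<phi>(1) bx ins V'[OF x(1)] by auto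
      ultimately have "\<phi> (b - x) = \<zero>" using R.add.r_cancel_one[of "\<phi> x" "\<phi> (b - x)"] by simp
      then have "b = x" using insert.prems(3)[OF bx] by simp
      then show False using bB x(1) by simp
    qed
    moreover have "R.line_extension (range \<kappa>) (\<phi> b) (\<phi> ` span B) = \<phi> ` span (insert b B)"
    proof (intro equalityI subsetI)
      fix u assume "u \<in> R.line_extension (range \<kappa>) (\<phi> b) (\<phi> ` span B)"
      then obtain c x where cx: "x \<in> span B" "u = \<kappa> c \<otimes> \<phi> b \<oplus> \<phi> x"
        unfolding R.line_extension_mem_iff by auto
      then have "u = \<phi> (scale c b + x)"
        using \<phi>(2)[of "scale c b" x] \<phi>(3)[of b c] b(2) V' V subspace_scale by simp
      moreover have "scale c b + x \<in> span (insert b B)"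
        using b(1) cx(1) sub span_add span_scale by blast
      ultimately show "u \<in> \<phi> ` span (insert b B)" by blast
    next
      fix u assume "u \<in> \<phi> ` span (insert b B)"
      then obtain y where y: "y \<in> span (insert b B)" "u = \<phi> y" by blast
      then obtain c where c: "y - scale c b \<in> span B" using span_breakdown_eq by blast
      have "u = \<kappa> c \<otimes> \<phi> b \<oplus> \<phi> (y - scale c b)"
        using \<phi>(2)[of "scale c b" "y - scale c b"] \<phi>(3)[of b c] b(2) V'[OF c] V subspace_scale y(2) by simp
      then show "u \<in> R.line_extension (range \<kappa>) (\<phi> b) (\<phi> ` span B)"
        unfolding R.line_extension_mem_iff using c by blast
    qed
    ultimately have "R.dimension (Suc (card B)) (range \<kappa>) (\<phi> ` span (insert b B))"
      using R.Suc_dim[OF \<phi>(1)[OF b(2)] _ IH] by simp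
    then show ?case using insert.hyps by simp
  qed
qed

lemma subspace_homogeneous: "mp.subspace {p. homogeneous e p}"
  by (rule mp.subspaceI) (auto intro: homogeneous_scale)

lemma subspace_ideal: "homogeneous_ideal I \<Longrightarrow> mp.subspace I"
  by (rule mp.subspaceI) (simp_all add: homogeneous_idealD)

lemma subspace_bounded_degree: "mp.subspace {p. \<forall>\<alpha>. mdeg \<alpha> > M \<longrightarrow> Poly_Mapping.lookup p \<alpha> = 0}"
  by (rule mp.subspaceI) (simp_all add: lookup_add lookup_const_mult)

text \<open>These are the finite spanning sets demanded by the dimension lemmas.\<close>

definition monomials_upto :: "nat \<Rightarrow> ('v::finite, 'k::field) mpoly set"
  where "monomials_upto M = (\<lambda>\<alpha>. Poly_Mapping.single \<alpha> 1) ` {\<alpha>. mdeg \<alpha> \<le> M}"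

lemma finite_monomials_upto: "finite (monomials_upto M)"
  unfolding monomials_upto_def by (rule finite_imageI[OF finite_mdeg_le])

lemma bounded_degree_span:
  "{p. \<forall>\<alpha>. mdeg \<alpha> > M \<longrightarrow> Poly_Mapping.lookup p \<alpha> = 0} \<subseteq> mp.span (monomials_upto M)"
proof
  fix p :: "('v::finite, 'k::field) mpoly" assume "p \<in> {p. \<forall>\<alpha>. mdeg \<alpha> > M \<longrightarrow> Poly_Mapping.lookup p \<alpha> = 0}"
  then have p: "mdeg \<alpha> \<le> M" if "\<alpha> \<in> Poly_Mapping.keys p" for \<alpha>
    using that by (simp add: in_keys_iff) (metis not_le)
  have "p = (\<Sum>\<alpha>\<in>Poly_Mapping.keys p. Poly_Mapping.single \<alpha> (Poly_Mapping.lookup p \<alpha>))"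
    by (rule poly_mapping_eqI) (auto simp: lookup_sum lookup_single when_def in_keys_iff)
  also have "\<dots> = (\<Sum>\<alpha>\<in>Poly_Mapping.keys p. const (Poly_Mapping.lookup p \<alpha>) * Poly_Mapping.single \<alpha> 1)"
    by (simp only: single_eq_const_mult[symmetric])
  also have "\<dots> \<in> mp.span (monomials_upto M)"
    by (intro mp.span_sum mp.span_scale mp.span_base) (auto simp: monomials_upto_def p)
  finally show "p \<in> mp.span (monomials_upto M)" .
qed

lemma homogeneous_span: "{p. homogeneous e p} \<subseteq> mp.span (monomials_upto e)"
  using bounded_degree_span[of e] by (auto simp: homogeneous_lookup)

text \<open>
  On a zero-dimensional scheme the set of variables not vanishing at \<open>P\<close> is locally constant in \<open>P\<close>.
  The choice below depends on \<open>P\<close> only through this set, so its powers trivialise the twists.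
\<close>

definition twisted_section :: "('v::finite, 'k::field) mpoly set \<Rightarrow> nat \<Rightarrow> ('v, 'k) mpoly \<Rightarrow>
    ('v, 'k) mpoly set \<Rightarrow> (('v, 'k) mpoly \<times> ('v, 'k) mpoly) set"
  where "twisted_section I e a = (\<lambda>P\<in>proj I. fraction_class I P a (var (SOME i. var i \<notin> P) ^ e))"

context
  fixes I :: "('v::finite, 'k::field) mpoly set"
  assumes I: "homogeneous_ideal I" "proj_dim I = 0"
begin

lemma twisted_fraction:
  assumes "P \<in> proj I" "homogeneous e a"
  shows "(a, var (SOME i. var i \<notin> P) ^ e) \<in> fractions P"
proof (rule fractionsI)
  have "var (SOME i. var i \<notin> P) \<notin> P" by (rule someI_ex[OF projD(4)[OF assms(1)]])
  then show "var (SOME i. var i \<notin> P) ^ e \<notin> P" by (rule proj_power_notin[OF assms(1)])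
  show "homogeneous e (var (SOME i. var i \<notin> P) ^ e :: ('v, 'k) mpoly)" by (rule homogeneous_var_power)
qed (rule assms(2))

lemma twisted_section_mem:
  assumes a: "homogeneous e a" shows "twisted_section I e a \<in> sections I"
proof (rule sectionsI)
  show "twisted_section I e a P = undefined" if "P \<notin> proj I" for P
    using that by (simp add: twisted_section_def)
  fix P assume P: "P \<in> proj I"
  obtain h d where h: "homogeneous d h" "h \<notin> P"
    "\<And>Q i. Q \<in> proj I \<Longrightarrow> h \<notin> Q \<Longrightarrow> var i \<notin> Q \<longleftrightarrow> var i \<notin> P"
    using proj_dim_zero_vars_locally_constant[OF I P] by metis
  show "\<exists>h d b f. homogeneous d h \<and> h \<notin> P \<and> (\<forall>Q\<in>proj I. h \<notin> Q \<longrightarrow>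
      (b, f) \<in> fractions Q \<and> twisted_section I e a Q = fraction_class I Q b f)"
  proof (intro exI conjI ballI impI)
    show "homogeneous d h" "h \<notin> P" by (rule h)+
    fix Q assume Q: "Q \<in> proj I" "h \<notin> Q"
    \<comment> \<open>\<open>SOME\<close> is applied to the same predicate at both points, so it
      selects the same variable throughout the neighbourhood.\<close>
    have eq: "(SOME i. var i \<notin> Q) = (SOME i. var i \<notin> P)" using h(3)[OF Q] by simp
    show "(a, var (SOME i. var i \<notin> P) ^ e) \<in> fractions Q" using twisted_fraction[OF Q(1) a] by (simp only: eq)
    show "twisted_section I e a Q = fraction_class I Q a (var (SOME i. var i \<notin> P) ^ e)"
      using Q(1) by (simp only: twisted_section_def restrict_apply' eq)
  qed
qed

lemma twisted_section_add:
  assumes ab: "homogeneous e a" "homogeneous e b"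
  shows "twisted_section I e (a + b) = twisted_section I e a \<oplus>\<^bsub>section_ring I\<^esub> twisted_section I e b"
proof (rule sections_ext)
  show "twisted_section I e (a + b) \<in> sections I" by (intro twisted_section_mem homogeneous_add ab)
  show "twisted_section I e a \<oplus>\<^bsub>section_ring I\<^esub> twisted_section I e b \<in> sections I"
    by (intro section_add_mem[OF I(1)] twisted_section_mem ab)
  fix P assume P: "P \<in> proj I"
  note ta = twisted_fraction[OF P ab(1)] and tb = twisted_fraction[OF P ab(2)]
  show "twisted_section I e (a + b) P = (twisted_section I e a \<oplus>\<^bsub>section_ring I\<^esub> twisted_section I e b) P"
    unfolding section_ring_apply[OF P] twisted_section_def restrict_apply'[OF P]
      stalk_add_fraction_class[OF I(1) P ta tb]
    by (rule fraction_class_eqI[OF I(1) P twisted_fraction[OF P] fractions_add[OF P ta tb]])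
      (use ab in \<open>auto simp: algebra_simps\<close>)
qed

lemma twisted_section_scale:
  assumes a: "homogeneous e a"
  shows "twisted_section I e (const c * a) = const_section I c \<otimes>\<^bsub>section_ring I\<^esub> twisted_section I e a"
proof (rule sections_ext)
  show "twisted_section I e (const c * a) \<in> sections I" by (intro twisted_section_mem homogeneous_scale a)
  show "const_section I c \<otimes>\<^bsub>section_ring I\<^esub> twisted_section I e a \<in> sections I"
    by (intro section_mult_mem[OF I(1)] const_section_mem twisted_section_mem a)
  fix P assume P: "P \<in> proj I"
  note ta = twisted_fraction[OF P a] and fc = fractions_const[OF P]
  show "twisted_section I e (const c * a) P = (const_section I c \<otimes>\<^bsub>section_ring I\<^esub> twisted_section I e a) P"
    unfolding section_ring_apply[OF P] const_section_apply[OF P] twisted_section_def restrict_apply'[OF P]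
      stalk_mult_fraction_class[OF I(1) P fc ta] by simp
qed

text \<open>Saturation turns the vanishing of all germs into membership in \<open>I\<close>: each
  zero germ yields a local annihilator, and \<open>saturated_memI\<close> combines them.\<close>

lemma twisted_section_eq_zero_iff:
  assumes sat: "saturated I" and a: "homogeneous e a"
  shows "twisted_section I e a = const_section I 0 \<longleftrightarrow> a \<in> I"
proof
  assume eq: "twisted_section I e a = const_section I 0"
  show "a \<in> I"
  proof (rule saturated_memI[OF I(1) sat a])
    fix P assume P: "P \<in> proj I"
    have "fraction_class I P a (var (SOME i. var i \<notin> P) ^ e) = fraction_class I P (const 0) 1"
      using fun_cong[OF eq, of P] P by (simp only: twisted_section_def restrict_apply' const_section_def)
    then have "(const 0, 1) \<in> fraction_class I P a (var (SOME i. var i \<notin> P) ^ e)"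
      by (rule fraction_class_eq_iff[OF I(1) P twisted_fraction[OF P a] fractions_const[OF P], THEN iffD1])
    then obtain h d where "h \<notin> P" "h * (a * 1 - const 0 * var (SOME i. var i \<notin> P) ^ e) \<in> I"
      by (rule mem_fraction_classE)
    then show "\<exists>h. h \<notin> P \<and> h * a \<in> I" by auto
  qed
next
  assume aI: "a \<in> I"
  show "twisted_section I e a = const_section I 0"
  proof (rule sections_ext[OF twisted_section_mem[OF a] const_section_mem])
    fix P assume P: "P \<in> proj I"
    have "(const 0, 1) \<in> fraction_class I P a (var (SOME i. var i \<notin> P) ^ e)"
      using fractions_const[OF P, of 0] projD(5)[OF P] aI
      by (intro mem_fraction_classI[of _ _ _ 0 1]) simp_all
    then show "twisted_section I e a P = const_section I 0 P"
      unfolding twisted_section_def restrict_apply'[OF P] const_section_apply[OF P]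
      by (rule fraction_class_eq_iff[OF I(1) P twisted_fraction[OF P a] fractions_const[OF P], THEN iffD2])
  qed
qed

lemma subfield_const_section: "subfield (range (const_section I)) (section_ring I)"
proof (rule subfield_range_hom)
  show "ring (section_ring I)" using cring_section_ring[OF I(1)] by (rule cring.axioms(1))
  show "const_section I c \<in> carrier (section_ring I)" for c
    using const_section_mem by (simp add: section_ring_simps)
  \<comment> \<open>Dimension zero provides a point, and \<open>1 = 0\<close> in its stalk would put
    an element outside \<open>P\<close> into \<open>I\<close>.\<close>
  obtain P where P: "P \<in> proj I" using proj_dim_zeroD(1)[OF I(2)] by blast
  show "\<one>\<^bsub>section_ring I\<^esub> \<noteq> \<zero>\<^bsub>section_ring I\<^esub>"
  proof
    assume "\<one>\<^bsub>section_ring I\<^esub> = \<zero>\<^bsub>section_ring I\<^esub>"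
    then have "fraction_class I P (const 1) 1 = fraction_class I P (const 0) 1"
      by (simp only: section_ring_simps flip: const_section_apply[OF P])
    then have "(const 0, 1) \<in> fraction_class I P (const 1) 1"
      by (rule fraction_class_eq_iff[OF I(1) P fractions_const[OF P] fractions_const[OF P], THEN iffD1])
    then obtain h d where "h \<notin> P" "h * (const 1 * 1 - const 0 * 1) \<in> I"
      by (rule mem_fraction_classE)
    then show False using projD(3)[OF P] by auto
  qed
qed (simp_all add: const_section_hom[OF I(1)] section_ring_simps)

text \<open>On forms of degree \<open>e\<close> the map has the degree \<open>e\<close> part of
  \<open>I\<close> as kernel, so a complement of that part maps isomorphically onto the image. Thus
  \<open>n\<close> is the Hilbert function of \<open>S/I\<close> at \<open>e\<close>.\<close>

lemma dimension_twisted_sections: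
  assumes sat: "saturated I"
  obtains n where "n + mp.dim (I \<inter> {p. homogeneous e p}) = mp.dim {p :: ('v, 'k) mpoly. homogeneous e p}"
    "ring.dimension (section_ring I) n (range (const_section I)) (twisted_section I e ` {p. homogeneous e p})"
proof -
  let ?R = "section_ring I" and ?V = "{p :: ('v, 'k) mpoly. homogeneous e p}"
  have R: "ring ?R" using cring_section_ring[OF I(1)] by (rule cring.axioms(1))
  obtain B where B: "finite B" "B \<subseteq> ?V" "mp.independent B" "card B + mp.dim (I \<inter> ?V) = mp.dim ?V"
    "mp.span B \<inter> (I \<inter> ?V) = {0}" "\<And>y. y \<in> ?V \<Longrightarrow> \<exists>b\<in>mp.span B. \<exists>x\<in>I \<inter> ?V. y = b + x"
    by (rule mp.complement_basis[OF mp.subspace_inter[OF subspace_ideal[OF I(1)] subspace_homogeneous]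
      subspace_homogeneous _ finite_monomials_upto homogeneous_span, of e]) auto
  have BV: "mp.span B \<subseteq> ?V" using B(2) subspace_homogeneous mp.span_minimal by blast
  have "ring.dimension ?R (card B) (range (const_section I)) (twisted_section I e ` mp.span B)"
  proof (rule mp.dimension_image_span[OF R subspace_homogeneous B(1,3,2)])
    show "twisted_section I e x \<in> carrier ?R" if "x \<in> ?V" for x
      using twisted_section_mem that by (simp add: section_ring_simps)
    show "x = 0" if "x \<in> mp.span B" "twisted_section I e x = \<zero>\<^bsub>?R\<^esub>" for x
    proof -
      have "x \<in> ?V" using that BV by blast
      then have "x \<in> I" using that(2) twisted_section_eq_zero_iff[OF sat] by (simp add: section_ring_simps)
      then show ?thesis using \<open>x \<in> ?V\<close> that(1) B(5) by blast
    qed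
  qed (simp_all add: twisted_section_add twisted_section_scale)
  moreover have "twisted_section I e ` mp.span B = twisted_section I e ` ?V"
  proof (rule equalityI[OF image_mono[OF BV] subsetI])
    fix s assume "s \<in> twisted_section I e ` ?V"
    then obtain y where y: "y \<in> ?V" "s = twisted_section I e y" by blast
    then obtain b x where bx: "b \<in> mp.span B" "x \<in> I" "x \<in> ?V" "y = b + x" using B(6) by blast
    interpret R: ring ?R by (rule R)
    have b: "b \<in> ?V" using bx(1) BV by blast
    have "s = twisted_section I e b \<oplus>\<^bsub>?R\<^esub> \<zero>\<^bsub>?R\<^esub>"
      using twisted_section_add[of e b x] b bx(2,3) twisted_section_eq_zero_iff[OF sat, of e x] y(2) bx(4)
      by (simp add: section_ring_simps(3))
    also have "\<dots> = twisted_section I e b"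
      using twisted_section_mem[of e b] b by (intro R.r_zero) (simp add: section_ring_simps)
    finally show "s \<in> twisted_section I e ` mp.span B" using bx(1) by blast
  qed
  ultimately have "ring.dimension ?R (card B) (range (const_section I)) (twisted_section I e ` ?V)" by simp
  then show thesis by (rule that[OF B(4)])
qed

text \<open>A basis of the twisted sections of degree \<open>e\<close> is an independent list in a
  space of dimension \<open>r\<close>.\<close>

lemma hilbert_function_le_scheme_degree:
  assumes sat: "saturated I" and r: "has_scheme_degree I r"
  shows "mp.dim {p :: ('v, 'k) mpoly. homogeneous e p} \<le> r + mp.dim (I \<inter> {p. homogeneous e p})"
proof -
  let ?R = "section_ring I" and ?K = "range (const_section I)"
  interpret R: ring ?R using cring_section_ring[OF I(1)] by (rule cring.axioms(1))
  obtain n where n: "n + mp.dim (I \<inter> {p. homogeneous e p}) = mp.dim {p :: ('v, 'k) mpoly. homogeneous e p}"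
    "R.dimension (n) ?K (twisted_section I e ` {p. homogeneous e p})"
    by (rule dimension_twisted_sections[OF sat])
  obtain Vs where Vs: "set Vs \<subseteq> carrier ?R" "R.independent ?K Vs" "length Vs = n"
    using R.exists_base[OF subfield_const_section n(2)] by blast
  have "length Vs \<le> r"
    using R.independent_length_le_dimension[OF subfield_const_section _ Vs(2,1)] r
    unfolding has_scheme_degree_def by blast
  then show ?thesis using n(1) Vs(3) by simp
qed

text \<open>Meant for schemes all of whose sections come from forms of a single degree; the section
  ring then inherits finite dimension from that graded piece.\<close>

lemma has_scheme_degree_exI:
  assumes sat: "saturated I" and surj: "\<And>s. s \<in> sections I \<Longrightarrow> \<exists>a. homogeneous e a \<and> s = twisted_section I e a"
  shows "\<exists>r. has_scheme_degree I r"
proof -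
  have "twisted_section I e ` {p. homogeneous e p} = carrier (section_ring I)"
    using surj twisted_section_mem by (auto simp: section_ring_simps)
  then show ?thesis using dimension_twisted_sections[OF sat, of e] unfolding has_scheme_degree_def by metis
qed

end

section \<open>Annihilators and the Bezout inequality\<close>

lemma mdeg_induct [case_names zero add_single]:
  assumes "P 0" "\<And>i \<alpha>. P \<alpha> \<Longrightarrow> P (Poly_Mapping.single i 1 + \<alpha>)"
  shows "P (\<alpha> :: 'v::finite \<Rightarrow>\<^sub>0 nat)"
proof (induction "mdeg \<alpha>" arbitrary: \<alpha>)
  case 0
  then have "\<alpha> = 0" by (intro poly_mapping_eqI) (simp add: mdeg_def)
  then show ?case using assms(1) by simp
next
  case (Suc n)
  obtain i where i: "Poly_Mapping.lookup \<alpha> i \<noteq> 0"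
    using Suc.hyps(2) by (force simp: mdeg_def)
  define \<beta> where "\<beta> = \<alpha> - Poly_Mapping.single i 1"
  have \<alpha>: "\<alpha> = Poly_Mapping.single i 1 + \<beta>"
    unfolding \<beta>_def using i by (intro poly_mapping_eqI) (auto simp: lookup_add lookup_minus lookup_single when_def)
  then have "mdeg \<alpha> = Suc (mdeg \<beta>)" by simp
  then have "n = mdeg \<beta>" using Suc.hyps(2) by simp
  then show ?case using assms(2)[OF Suc.hyps(1)] \<alpha> by simp
qed

lemma partial_monom_zero: "partial_monom 0 F = F"
  using partial_monom_single[of undefined 0 F] by simp

lemma mdeg_partial_monom:
  assumes F: "homogeneous m F" and "Poly_Mapping.lookup (partial_monom \<alpha> F) \<beta> \<noteq> 0"
  shows "mdeg \<beta> + mdeg \<alpha> = m"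
  using assms(2)
proof (induction \<alpha> arbitrary: \<beta> rule: mdeg_induct)
  case zero
  then show ?case using F by (auto simp: partial_monom_zero homogeneous_lookup)
next
  case (add_single i \<alpha>)
  have "partial_monom (Poly_Mapping.single i 1 + \<alpha>) F = partial i (partial_monom \<alpha> F)"
    using partial_monom_single[of i 1 "partial_monom \<alpha> F"] by (simp only: partial_monom_add) simp
  then have "Poly_Mapping.lookup (partial_monom \<alpha> F) (\<beta> + Poly_Mapping.single i 1) \<noteq> 0"
    using add_single.prems by (auto simp: lookup_partial)
  from add_single.IH[OF this] show ?case by simp
qed

text \<open>Every derivative of order above \<open>m\<close> kills \<open>F\<close>. This fact puts
  powers of variables and fat points into the annihilator and makes \<open>S\<close> modulo the
  annihilator finite-dimensional.\<close>

lemma mem_annihilator_if_large_degree: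
  assumes F: "homogeneous m F" and g: "\<And>\<alpha>. mdeg \<alpha> \<le> m \<Longrightarrow> Poly_Mapping.lookup g \<alpha> = 0"
  shows "g \<in> annihilator F"
proof -
  have "partial_monom \<alpha> F = 0" if "\<alpha> \<in> Poly_Mapping.keys g" for \<alpha>
  proof (rule poly_mapping_eqI, rule ccontr)
    fix \<beta> assume "Poly_Mapping.lookup (partial_monom \<alpha> F) \<beta> \<noteq> Poly_Mapping.lookup 0 \<beta>"
    then have "mdeg \<beta> + mdeg \<alpha> = m" by (intro mdeg_partial_monom[OF F]) simp
    then have "Poly_Mapping.lookup g \<alpha> = 0" by (intro g) simp
    then show False using that by (simp add: in_keys_iff)
  qed
  then show ?thesis by (simp add: annihilator_def apolar_act_def)
qed

lemma one_notin_annihilator: "F \<noteq> 0 \<Longrightarrow> 1 \<notin> annihilator F"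
  using apolar_act_const[of 1 F] by (simp add: annihilator_def)

lemma Idl_mem: "g \<in> G \<Longrightarrow> g \<in> Idl\<^bsub>\<S>\<^esub> G"
  using ring.genideal_self[OF ring_poly_ring, of G] by auto

lemma Idl_subset: "ideal I \<S> \<Longrightarrow> G \<subseteq> I \<Longrightarrow> Idl\<^bsub>\<S>\<^esub> G \<subseteq> I"
  by (rule ring.genideal_minimal[OF ring_poly_ring])

text \<open>The polynomials all of whose components lie in the generated ideal form an ideal
  containing the generators, hence containing everything these generate.\<close>

lemma homogeneous_ideal_Idl:
  assumes G: "\<And>g. g \<in> G \<Longrightarrow> \<exists>e. homogeneous e g"
  shows "homogeneous_ideal (Idl\<^bsub>\<S>\<^esub> G)"
proof -
  let ?J = "Idl\<^bsub>\<S>\<^esub> G" and ?Q = "{p. \<forall>e. hcomp e p \<in> Idl\<^bsub>\<S>\<^esub> G}"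
  have J: "ideal ?J \<S>" by (rule ring.genideal_ideal[OF ring_poly_ring]) simp
  note JD = J[unfolded ideal_poly_ring_iff]
  have sum: "(\<Sum>k\<in>A. f k) \<in> ?J" if "\<And>k. k \<in> A \<Longrightarrow> f k \<in> ?J" for A :: "nat set" and f
    using that by (induction A rule: infinite_finite_induct) (use JD in auto)
  have "ideal ?Q \<S>"
    unfolding ideal_poly_ring_iff
  proof (intro conjI ballI allI)
    show "0 \<in> ?Q" using JD by simp
    fix p assume p: "p \<in> ?Q"
    show "p + q \<in> ?Q" if "q \<in> ?Q" for q using p that JD by (simp add: hcomp_add)
    show "r * p \<in> ?Q" for r
      unfolding mem_Collect_eq hcomp_mult by (intro allI sum) (use p JD in auto)
  qed
  moreover have "G \<subseteq> ?Q"
  proof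
    fix g assume g: "g \<in> G"
    then obtain d where "homogeneous d g" using G by blast
    then show "g \<in> ?Q" using Idl_mem[OF g] JD by (simp add: hcomp_homogeneous)
  qed
  ultimately have "?J \<subseteq> ?Q" by (rule Idl_subset)
  then show ?thesis unfolding homogeneous_ideal_def using J by blast
qed

section \<open>Counting dimensions with several multipliers\<close>

lemma linear_mult: "Vector_Spaces.linear (\<lambda>c p. const c * p) (\<lambda>c p. const c * p) ((*) (v :: ('v::finite, 'k::field) mpoly))"
  by unfold_locales (simp_all add: algebra_simps)

text \<open>The ideal \<open>I : v^infinity\<close>, the kernel of passing from \<open>S\<close> to
  the localisation of \<open>S/I\<close> at \<open>v\<close>.\<close>

definition torsion :: "('v::finite, 'k::field) mpoly set \<Rightarrow> ('v, 'k) mpoly \<Rightarrow> ('v, 'k) mpoly set"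
  where "torsion I v = {u. \<exists>N. v ^ N * u \<in> I}"

lemma subspace_torsion:
  assumes I: "homogeneous_ideal I" shows "mp.subspace (torsion I v)"
proof (rule mp.subspaceI)
  note ID = homogeneous_idealD[OF I]
  show "0 \<in> torsion I v" using ID(1) by (simp add: torsion_def)
  show "p + q \<in> torsion I v" if pq: "p \<in> torsion I v" "q \<in> torsion I v" for p q
  proof -
    obtain M where M: "v ^ M * p \<in> I" using pq(1) by (auto simp: torsion_def)
    obtain N where N: "v ^ N * q \<in> I" using pq(2) by (auto simp: torsion_def)
    have "v ^ (M + N) * (p + q) = v ^ N * (v ^ M * p) + v ^ M * (v ^ N * q)"
      by (simp add: power_add algebra_simps)
    also have "\<dots> \<in> I" using M N ID(2,3) by simp
    finally show ?thesis unfolding torsion_def by blast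
  qed
  show "const c * p \<in> torsion I v" if p: "p \<in> torsion I v" for c p
  proof -
    obtain N where N: "v ^ N * p \<in> I" using p by (auto simp: torsion_def)
    have "v ^ N * (const c * p) = const c * (v ^ N * p)" by (simp add: algebra_simps)
    also have "\<dots> \<in> I" using N ID(3) by simp
    finally show ?thesis unfolding torsion_def by blast
  qed
qed

text \<open>
  If a single \<open>v\<close> were a non-zero-divisor modulo \<open>I\<close>, multiplication by \<open>v\<close> would embed \<open>U/I\<close> into
  \<open>W/I\<close>.  Over a finite field no such \<open>v\<close> need exist among the forms of a given degree; instead, the
  part of \<open>U\<close> killed by powers of the first multipliers is embedded by the next one.
\<close>

lemma dim_le_of_multipliers:
  fixes I :: "('v::finite, 'k::field) mpoly set"
  assumes I: "homogeneous_ideal I" and fin: "finite A" "finite B"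
    and U: "mp.subspace U" "U \<subseteq> mp.span A" and W: "mp.subspace W" "W \<subseteq> mp.span B"
    and vs: "\<And>v u. v \<in> set vs \<Longrightarrow> u \<in> U \<Longrightarrow> v * u \<in> W"
  shows "mp.dim U + mp.dim (W \<inter> (\<Inter>v\<in>set vs. torsion I v)) \<le> mp.dim W + mp.dim (U \<inter> (\<Inter>v\<in>set vs. torsion I v))"
  using U W vs
proof (induction vs arbitrary: U W)
  case (Cons v vs)
  note tors = subspace_torsion[OF I]
  let ?U = "U \<inter> torsion I v" and ?W = "W \<inter> torsion I v"
  have sub: "mp.subspace ?U" "mp.subspace ?W" using Cons.prems(1,3) tors mp.subspace_inter by blast+
  \<comment> \<open>An element whose multiple by \<open>v\<close> is \<open>v\<close>-torsion is
    itself \<open>v\<close>-torsion, so \<open>U\<close> modulo torsion embeds in \<open>W\<close>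
    modulo torsion.\<close>
  have "mp.dim U + mp.dim ?W \<le> mp.dim W + mp.dim ?U"
  proof (rule mp.dim_le_of_linear_mod[OF Cons.prems(1) _ sub(1) fin(1) Cons.prems(2) Cons.prems(3) _ sub(2) fin(2) Cons.prems(4) linear_mult[of v]])
    show "(*) v ` U \<subseteq> W" using Cons.prems(5) by auto
    show "u \<in> ?U" if u: "u \<in> U" "v * u \<in> ?W" for u
    proof -
      obtain N where "v ^ N * (v * u) \<in> I" using u(2) by (auto simp: torsion_def)
      then have "v ^ Suc N * u \<in> I" by (simp add: algebra_simps)
      then show ?thesis using u(1) unfolding torsion_def by blast
    qed
  qed auto
  \<comment> \<open>By commutativity the remaining multipliers carry the \<open>v\<close>-torsion of
    \<open>U\<close> into that of \<open>W\<close>, so the induction hypothesis applies; adding the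
    two inequalities cancels the intermediate dimensions.\<close>
  moreover have "mp.dim ?U + mp.dim (?W \<inter> (\<Inter>v\<in>set vs. torsion I v)) \<le> mp.dim ?W + mp.dim (?U \<inter> (\<Inter>v\<in>set vs. torsion I v))"
  proof (rule Cons.IH[OF sub(1) _ sub(2)])
    show "?U \<subseteq> mp.span A" "?W \<subseteq> mp.span B" using Cons.prems by auto
    fix w u assume w: "w \<in> set vs" and u: "u \<in> ?U"
    obtain N where "v ^ N * u \<in> I" using u by (auto simp: torsion_def)
    then have "w * (v ^ N * u) \<in> I" by (rule homogeneous_idealD(3)[OF I])
    then have "v ^ N * (w * u) \<in> I" by (simp add: algebra_simps)
    moreover have "w * u \<in> W" using Cons.prems(5) w u by simp
    ultimately show "w * u \<in> ?W" unfolding torsion_def by blast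
  qed
  ultimately show ?case by (simp add: Int_assoc)
qed simp

text \<open>This is the radical of the colon ideal \<open>I : u\<close>. Being an ideal, it swallows
  all of \<open>J\<close> once it contains generators, and all forms of degree \<open>d\<close> in
  \<open>J\<close> once it contains a basis of them.\<close>

lemma radical_colon_ideal:
  assumes I: "homogeneous_ideal I" shows "ideal {p. \<exists>N. p ^ N * u \<in> I} \<S>"
  unfolding ideal_poly_ring_iff
proof (intro conjI ballI allI)
  let ?Q = "{p. \<exists>N. p ^ N * u \<in> I}"
  note ID = homogeneous_idealD[OF I]
  show "0 \<in> ?Q" using ID(1) by (intro CollectI exI[of _ 1]) simp
  fix p assume "p \<in> ?Q"
  then obtain M where M: "p ^ M * u \<in> I" by blast
  show "r * p \<in> ?Q" for r
    using ID(3)[OF M, of "r ^ M"] by (intro CollectI exI[of _ M]) (simp add: power_mult_distrib mult.assoc)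
  show "p + q \<in> ?Q" if q: "q \<in> ?Q" for q
  proof -
    obtain N where N: "q ^ N * u \<in> I" using q by blast
    \<comment> \<open>Terms of the binomial expansion at exponent \<open>M + N\<close>: in each one
      either \<open>p\<close> has exponent at least \<open>M\<close> or \<open>q\<close> has
      exponent at least \<open>N\<close>.\<close>
    have "of_nat (M + N choose k) * p ^ k * q ^ (M + N - k) * u \<in> I" if "k \<le> M + N" for k
    proof (cases "k \<ge> M")
      case True
      then obtain l where "k = M + l" using le_Suc_ex by blast
      then have "of_nat (M + N choose k) * p ^ k * q ^ (M + N - k) * u =
          (of_nat (M + N choose k) * p ^ l * q ^ (M + N - k)) * (p ^ M * u)"
        by (simp add: power_add algebra_simps)
      then show ?thesis using ID(3)[OF M] by simp
    next
      case False
      then have "N \<le> M + N - k" by simp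
      then obtain l where l: "M + N - k = N + l" using le_Suc_ex by blast
      have "of_nat (M + N choose k) * p ^ k * q ^ (M + N - k) * u =
          (of_nat (M + N choose k) * p ^ k * q ^ l) * (q ^ N * u)"
        unfolding l by (simp add: power_add algebra_simps)
      then show ?thesis using ID(3)[OF N] by simp
    qed
    then have "(\<Sum>k\<le>M + N. of_nat (M + N choose k) * p ^ k * q ^ (M + N - k) * u) \<in> I"
      by (intro homogeneous_ideal_sum[OF I]) simp
    then have "(p + q) ^ (M + N) * u \<in> I" by (simp only: binomial_ring sum_distrib_right)
    then show ?thesis by blast
  qed
qed

lemma saturatedD: "saturated I \<Longrightarrow> (\<And>i. \<exists>k. var i ^ k * p \<in> I) \<Longrightarrow> p \<in> I"
  unfolding saturated_def by blast

text \<open>A generator of degree \<open>e\<close> is brought to degree \<open>d\<close> by each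
  \<open>var l ^ (d - e)\<close>, and saturation strips these variables again. So the radical of
  \<open>I : u\<close> contains all generators, hence \<open>J\<close> and the powers of variables
  in it, and a second use of saturation yields \<open>u\<close>.\<close>

lemma torsion_subset_saturated:
  assumes I: "homogeneous_ideal I" "saturated I"
    and G: "\<And>g. g \<in> G \<Longrightarrow> \<exists>e\<le>d. homogeneous e g" and J: "J = Idl\<^bsub>\<S>\<^esub> G"
    and vars: "\<And>i. \<exists>k. var i ^ k \<in> J"
    and u: "\<And>v. v \<in> J \<Longrightarrow> homogeneous d v \<Longrightarrow> u \<in> torsion I v"
  shows "u \<in> I"
proof -
  note ID = homogeneous_idealD[OF I(1)]
  let ?Q = "{p. \<exists>N. p ^ N * u \<in> I}"
  have hJ: "homogeneous_ideal J" unfolding J using G by (intro homogeneous_ideal_Idl) blast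
  have "g \<in> ?Q" if g: "g \<in> G" for g
  proof -
    obtain e where e: "e \<le> d" "homogeneous e g" using G[OF g] by blast
    have "\<exists>N. (var l ^ (d - e) * g) ^ N * u \<in> I" for l
    proof -
      have "var l ^ (d - e) * g \<in> J" using homogeneous_idealD(3)[OF hJ] Idl_mem[OF g] J by blast
      moreover have "homogeneous d (var l ^ (d - e) * g)"
        using homogeneous_mult[OF homogeneous_var_power[of "d - e" l] e(2)] e(1) by simp
      ultimately show ?thesis using u unfolding torsion_def by blast
    qed
    then obtain N where N: "\<And>l. (var l ^ (d - e) * g) ^ N l * u \<in> I" by metis
    \<comment> \<open>One exponent for all of the finitely many variables: saturation has to be
      applied to the same element \<open>g ^ M * u\<close> for every \<open>l\<close>.\<close>
    define M where "M = Max (range N)"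
    have NM: "N l \<le> M" for l unfolding M_def by simp
    have "g ^ M * u \<in> I"
    proof (rule saturatedD[OF I(2)])
      fix l
      have "var l ^ ((d - e) * N l) * (g ^ M * u) = g ^ (M - N l) * ((var l ^ (d - e) * g) ^ N l * u)"
      proof -
        have "g ^ M = g ^ (M - N l) * g ^ N l" using NM[of l] by (simp flip: power_add)
        then show ?thesis unfolding power_mult power_mult_distrib by (simp add: ac_simps)
      qed
      then show "\<exists>k. var l ^ k * (g ^ M * u) \<in> I" using ID(3)[OF N] by metis
    qed
    then show ?thesis by blast
  qed
  then have JQ: "J \<subseteq> ?Q" unfolding J by (intro Idl_subset radical_colon_ideal[OF I(1)]) blast
  show ?thesis
  proof (rule saturatedD[OF I(2)])
    fix i
    obtain k where "var i ^ k \<in> J" using vars by blast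
    then obtain N where "(var i ^ k) ^ N * u \<in> I" using JQ by blast
    then show "\<exists>k. var i ^ k * u \<in> I" unfolding power_mult[symmetric] by blast
  qed
qed

text \<open>A basis of \<open>J\<close> in degree \<open>d\<close> supplies the multipliers. Their
  joint torsion is exactly \<open>I\<close>, so the general estimate compares \<open>S/I\<close> in
  degree \<open>e\<close> with \<open>J/I\<close> in degree \<open>e + d\<close>.\<close>

lemma hilbert_function_step:
  fixes I :: "('v::finite, 'k::field) mpoly set"
  assumes I: "homogeneous_ideal I" "saturated I" and IJ: "I \<subseteq> J"
    and G: "\<And>g. g \<in> G \<Longrightarrow> \<exists>e\<le>d. homogeneous e g" and J: "J = Idl\<^bsub>\<S>\<^esub> G"
    and vars: "\<And>i. \<exists>k. var i ^ k \<in> J"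
  shows "mp.dim {p :: ('v, 'k) mpoly. homogeneous e p} + mp.dim (I \<inter> {p. homogeneous (e + d) p})
    \<le> mp.dim (J \<inter> {p. homogeneous (e + d) p}) + mp.dim (I \<inter> {p. homogeneous e p})"
proof -
  have hJ: "homogeneous_ideal J" unfolding J using G by (intro homogeneous_ideal_Idl) blast
  have sub: "mp.subspace (J \<inter> {p. homogeneous n p})" for n
    using mp.subspace_inter[OF subspace_ideal[OF hJ] subspace_homogeneous] .
  obtain A where A: "A \<subseteq> J \<inter> {p. homogeneous d p}" "mp.independent A" "J \<inter> {p. homogeneous d p} \<subseteq> mp.span A"
    using mp.basis_exists by metis
  have sp: "J \<inter> {p. homogeneous n p} \<subseteq> mp.span (monomials_upto n)" for n
    using homogeneous_span by blast
  have "finite A" by (rule mp.card_le_dim(1)[OF A(2,1) finite_monomials_upto sp])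
  then obtain vs where vs: "set vs = A" using finite_list by blast
  have tors: "(\<Inter>v\<in>set vs. torsion I v) = I"
  proof
    show "I \<subseteq> (\<Inter>v\<in>set vs. torsion I v)" by (auto simp: torsion_def intro: exI[of _ 0])
    show "(\<Inter>v\<in>set vs. torsion I v) \<subseteq> I"
    proof
      fix u assume u: "u \<in> (\<Inter>v\<in>set vs. torsion I v)"
      let ?Q = "{p. \<exists>N. p ^ N * u \<in> I}"
      note Q = radical_colon_ideal[OF I(1), of u, unfolded ideal_poly_ring_iff]
      \<comment> \<open>The torsion condition is given on the basis only. It extends to all forms of
        degree \<open>d\<close> in \<open>J\<close> because the radical of \<open>I : u\<close> is a
        subspace.\<close>
      have "mp.subspace ?Q" by (rule mp.subspaceI) (use Q in blast)+
      moreover have "A \<subseteq> ?Q" using u vs by (auto simp: torsion_def)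
      ultimately have *: "mp.span A \<subseteq> ?Q" by (intro mp.span_minimal)
      show "u \<in> I"
      proof (rule torsion_subset_saturated[OF I G J vars])
        fix v assume "v \<in> J" "homogeneous d v"
        then have "v \<in> ?Q" using A(3) * by blast
        then show "u \<in> torsion I v" unfolding torsion_def by blast
      qed
    qed
  qed
  have "mp.dim {p :: ('v, 'k) mpoly. homogeneous e p} + mp.dim ((J \<inter> {p. homogeneous (e + d) p}) \<inter> (\<Inter>v\<in>set vs. torsion I v))
    \<le> mp.dim (J \<inter> {p. homogeneous (e + d) p}) + mp.dim ({p. homogeneous e p} \<inter> (\<Inter>v\<in>set vs. torsion I v))"
  proof (rule dim_le_of_multipliers[OF I(1) finite_monomials_upto finite_monomials_upto subspace_homogeneous homogeneous_span sub sp])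
    fix v u assume v: "v \<in> set vs" and u: "u \<in> {p :: ('v, 'k) mpoly. homogeneous e p}"
    have "v \<in> J" "homogeneous d v" using v vs A(1) by auto
    then show "v * u \<in> J \<inter> {p. homogeneous (e + d) p}"
      using homogeneous_idealD(4)[OF hJ] homogeneous_mult[of d v e u] u by (simp add: add.commute)
  qed
  moreover have "(J \<inter> {p. homogeneous (e + d) p}) \<inter> I = I \<inter> {p. homogeneous (e + d) p}" using IJ by blast
  ultimately show ?thesis unfolding tors by (simp add: Int_commute)
qed

text \<open>Induction peels off the top homogeneous component, which stays in \<open>J\<close>
  because \<open>J\<close> is homogeneous.\<close>

lemma dim_homogeneous_ideal_upto:
  fixes J :: "('v::finite, 'k::field) mpoly set"
  assumes J: "homogeneous_ideal J"
  shows "mp.dim (J \<inter> {p. \<forall>\<alpha>. mdeg \<alpha> > M \<longrightarrow> Poly_Mapping.lookup p \<alpha> = 0}) =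
    (\<Sum>e\<le>M. mp.dim (J \<inter> {p. homogeneous e p}))"
proof (induction M)
  case 0
  have "{p :: ('v, 'k) mpoly. \<forall>\<alpha>. mdeg \<alpha> > 0 \<longrightarrow> Poly_Mapping.lookup p \<alpha> = 0} = {p. homogeneous 0 p}"
    by (auto simp: homogeneous_lookup)
  then show ?case by simp
next
  case (Suc M)
  let ?U = "\<lambda>M. {p :: ('v, 'k) mpoly. \<forall>\<alpha>. mdeg \<alpha> > M \<longrightarrow> Poly_Mapping.lookup p \<alpha> = 0}"
  let ?S = "{p :: ('v, 'k) mpoly. homogeneous (Suc M) p}"
  have sub: "mp.subspace (J \<inter> ?U M)" "mp.subspace (J \<inter> ?S)"
    by (intro mp.subspace_inter subspace_ideal[OF J] subspace_bounded_degree subspace_homogeneous)+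
  have le: "?U M \<subseteq> ?U (Suc M)" "?S \<subseteq> ?U (Suc M)" by (auto simp: homogeneous_lookup)
  have sp: "J \<inter> ?U M \<subseteq> mp.span (monomials_upto (Suc M))" "J \<inter> ?S \<subseteq> mp.span (monomials_upto (Suc M))"
    using subset_trans[OF le(1) bounded_degree_span] subset_trans[OF le(2) bounded_degree_span]
    by (simp_all add: le_infI2)
  have zero: "(J \<inter> ?U M) \<inter> (J \<inter> ?S) = {0}"
  proof
    show "(J \<inter> ?U M) \<inter> (J \<inter> ?S) \<subseteq> {0}"
    proof
      fix p assume p: "p \<in> (J \<inter> ?U M) \<inter> (J \<inter> ?S)"
      have "Poly_Mapping.lookup p \<alpha> = 0" for \<alpha>
        using p by (cases "mdeg \<alpha> = Suc M") (auto simp: homogeneous_lookup)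
      then show "p \<in> {0}" by (simp add: poly_mapping_eqI)
    qed
    show "{0} \<subseteq> (J \<inter> ?U M) \<inter> (J \<inter> ?S)" using homogeneous_idealD(1)[OF J] by simp
  qed
  have "J \<inter> ?U (Suc M) = {x + y |x y. x \<in> J \<inter> ?U M \<and> y \<in> J \<inter> ?S}"
  proof (intro equalityI subsetI)
    fix p assume p: "p \<in> J \<inter> ?U (Suc M)"
    have h: "hcomp (Suc M) p \<in> J" using homogeneous_idealD(6)[OF J] p by blast
    have "p - hcomp (Suc M) p \<in> ?U M"
      using p by (auto simp: lookup_minus lookup_hcomp)
    moreover have "p - hcomp (Suc M) p \<in> J" using homogeneous_idealD(5)[OF J _ h] p by blast
    ultimately show "p \<in> {x + y |x y. x \<in> J \<inter> ?U M \<and> y \<in> J \<inter> ?S}"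
      using h by (intro CollectI exI[of _ "p - hcomp (Suc M) p"] exI[of _ "hcomp (Suc M) p"]) simp
  next
    fix p assume "p \<in> {x + y |x y. x \<in> J \<inter> ?U M \<and> y \<in> J \<inter> ?S}"
    then obtain x y where xy: "x \<in> J \<inter> ?U M" "y \<in> J \<inter> ?S" "p = x + y" by blast
    then have "p \<in> J" using homogeneous_idealD(2)[OF J] by blast
    moreover have "p \<in> ?U (Suc M)" using xy by (auto simp: lookup_add homogeneous_lookup)
    ultimately show "p \<in> J \<inter> ?U (Suc M)" by blast
  qed
  then have "mp.dim (J \<inter> ?U (Suc M)) = mp.dim (J \<inter> ?U M) + mp.dim (J \<inter> ?S)"
    using mp.dim_direct_sum[OF sub finite_monomials_upto sp zero] by simp
  then show ?case using Suc.IH by simp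
qed

text \<open>From degree \<open>m + 1\<close> on every form annihilates \<open>F\<close>, so the
  polynomials of degree at most \<open>M\<close> already represent all residue classes.\<close>

lemma annihilator_degree_eq:
  fixes F :: "('v::finite, 'k::field) mpoly"
  assumes F: "F \<noteq> 0" "homogeneous m F" and J: "homogeneous_ideal (annihilator F)" and M: "m \<le> M"
  shows "annihilator_degree F + (\<Sum>e\<le>M. mp.dim (annihilator F \<inter> {p. homogeneous e p})) =
    (\<Sum>e\<le>M. mp.dim {p :: ('v, 'k) mpoly. homogeneous e p})"
proof -
  let ?J = "annihilator F" and ?\<phi> = "\<lambda>p. annihilator F +>\<^bsub>\<S>\<^esub> p"
  let ?U = "{p :: ('v, 'k) mpoly. \<forall>\<alpha>. mdeg \<alpha> > M \<longrightarrow> Poly_Mapping.lookup p \<alpha> = 0}"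
  let ?R = "\<S> Quot ?J"
  have id: "ideal ?J \<S>" using J by (simp add: homogeneous_ideal_def)
  interpret J: ideal ?J \<S> by (rule id)
  interpret R: ring ?R by (rule J.quotient_is_ring)
  have hom: "?\<phi> \<in> ring_hom \<S> ?R" by (rule J.rcos_ring_hom)
  have \<phi>: "?\<phi> p \<in> carrier ?R" "?\<phi> (p + q) = ?\<phi> p \<oplus>\<^bsub>?R\<^esub> ?\<phi> q" "?\<phi> (p * q) = ?\<phi> p \<otimes>\<^bsub>?R\<^esub> ?\<phi> q"
    "?\<phi> 1 = \<one>\<^bsub>?R\<^esub>" for p q
    using ring_hom_closed[OF hom, of p] ring_hom_add[OF hom, of p q] ring_hom_mult[OF hom, of p q] ring_hom_one[OF hom]
    by simp_all
  have zero: "\<zero>\<^bsub>?R\<^esub> = ?J" by (simp add: FactRing_def)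
  have ker: "p \<in> ?J" if "?\<phi> p = \<zero>\<^bsub>?R\<^esub>" for p
    using J.a_rcos_self[of p] that zero by simp
  have \<phi>0: "?\<phi> p = \<zero>\<^bsub>?R\<^esub>" if "p \<in> ?J" for p
    using J.a_rcos_const[OF that] zero by simp
  have sub: "mp.subspace (?J \<inter> ?U)" using mp.subspace_inter[OF subspace_ideal[OF J] subspace_bounded_degree] .
  obtain B where B: "finite B" "B \<subseteq> ?U" "mp.independent B" "card B + mp.dim (?J \<inter> ?U) = mp.dim ?U"
    "mp.span B \<inter> (?J \<inter> ?U) = {0}" "\<And>y. y \<in> ?U \<Longrightarrow> \<exists>b\<in>mp.span B. \<exists>x\<in>?J \<inter> ?U. y = b + x"
    by (rule mp.complement_basis[OF sub subspace_bounded_degree _ finite_monomials_upto bounded_degree_span]) blast+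
  have BU: "mp.span B \<subseteq> ?U" using B(2) subspace_bounded_degree mp.span_minimal by blast
  have "R.dimension (card B) (range (\<lambda>c. ?\<phi> (const c))) (?\<phi> ` mp.span B)"
  proof (rule mp.dimension_image_span[OF R.ring_axioms subspace_bounded_degree B(1,3,2)])
    show "x = 0" if "x \<in> mp.span B" "?\<phi> x = \<zero>\<^bsub>?R\<^esub>" for x
      using ker[OF that(2)] that(1) B(5) BU by blast
  qed (simp_all only: \<phi>)
  moreover have "?\<phi> ` mp.span B = carrier ?R"
  proof (rule equalityI)
    show "?\<phi> ` mp.span B \<subseteq> carrier ?R" using \<phi>(1) by blast
    show "carrier ?R \<subseteq> ?\<phi> ` mp.span B"
    proof
      fix y assume "y \<in> carrier ?R"
      then obtain p where p: "y = ?\<phi> p" by (auto simp: FactRing_def A_RCOSETS_def')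
      \<comment> \<open>What this truncation cuts off consists of monomials of degree above
        \<open>m\<close> and therefore lies in the annihilator.\<close>
      let ?q = "\<Sum>e\<le>M. hcomp e p"
      have lq: "Poly_Mapping.lookup ?q \<alpha> = (if mdeg \<alpha> \<le> M then Poly_Mapping.lookup p \<alpha> else 0)" for \<alpha>
        by (simp add: lookup_sum lookup_hcomp)
      then have "?q \<in> ?U" by simp
      then obtain b x where bx: "b \<in> mp.span B" "x \<in> ?J" "?q = b + x" using B(6) by blast
      have "p - ?q \<in> ?J"
        by (rule mem_annihilator_if_large_degree[OF F(2)]) (use M lq in \<open>simp add: lookup_minus\<close>)
      then have "x + (p - ?q) \<in> ?J" using homogeneous_idealD(2)[OF J bx(2)] by blast
      then have *: "?\<phi> b \<oplus>\<^bsub>?R\<^esub> ?\<phi> (x + (p - ?q)) = ?\<phi> b" using \<phi>0 \<phi>(1) R.r_zero by metis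
      have "p = b + (x + (p - ?q))" using bx(3) by (simp add: algebra_simps)
      then have "?\<phi> p = ?\<phi> (b + (x + (p - ?q)))" by (rule arg_cong)
      also have "\<dots> = ?\<phi> b" using * by (simp only: \<phi>(2))
      finally have "?\<phi> p = ?\<phi> b" .
      then show "y \<in> ?\<phi> ` mp.span B" using p bx(1) by blast
    qed
  qed
  ultimately have dim: "R.dimension (card B) (range (\<lambda>c. ?\<phi> (const c))) (carrier ?R)" by simp
  have "\<one>\<^bsub>?R\<^esub> \<noteq> \<zero>\<^bsub>?R\<^esub>" using ker[of 1] one_notin_annihilator[OF F(1)] \<phi>(4) by auto
  then have "subfield (range (\<lambda>c. ?\<phi> (const c))) ?R"
    by (intro subfield_range_hom R.ring_axioms) (simp_all add: \<phi>)
  then have "annihilator_degree F = card B"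
    using R.dimI[OF _ dim] unfolding annihilator_degree_def over_def by simp
  moreover have "homogeneous_ideal (UNIV :: ('v, 'k) mpoly set)" by (simp add: homogeneous_ideal_iff)
  then have "mp.dim ?U = (\<Sum>e\<le>M. mp.dim {p :: ('v, 'k) mpoly. homogeneous e p})"
    using dim_homogeneous_ideal_upto[of UNIV M] by simp
  ultimately show ?thesis using B(4) dim_homogeneous_ideal_upto[OF J, of M] by simp
qed

text \<open>Here \<open>s\<close>, \<open>i\<close> and \<open>j\<close> are the dimensions of the
  graded pieces of \<open>S\<close>, \<open>I\<close> and \<open>J\<close>, so \<open>s - i\<close>
  is the Hilbert function of \<open>S/I\<close>. Summing the step estimate bounds the sum of
  \<open>s - j\<close> by the sum of \<open>s - i\<close> over the last \<open>d\<close>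
  degrees.\<close>

lemma sum_telescope_le:
  fixes s i j :: "nat \<Rightarrow> nat"
  assumes "\<And>e. s e \<le> r + i e" "\<And>e. i e \<le> s e" "\<And>e. i e \<le> j e" "\<And>e. s e + i (e + d) \<le> j (e + d) + i e"
  shows "(\<Sum>e<M + d. s e) \<le> d * r + (\<Sum>e<M + d. j e)"
proof -
  have "(\<Sum>e<d. s e) \<le> d * r + (\<Sum>e<d. j e)"
  proof (induction d)
    case (Suc d)
    have "s d \<le> r + j d" using assms(1,3)[of d] by linarith
    then show ?case using Suc.IH by simp
  qed simp
  \<comment> \<open>The last assumption added up over \<open>e < M\<close>. The base case covers the
    first \<open>d\<close> degrees, where \<open>i \<le> j\<close> is used instead.\<close>
  have shift: "(\<Sum>e<M + d. s e) + (\<Sum>e<M. s e) + (\<Sum>e<M + d. i e) \<le>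
      (\<Sum>e<M + d. j e) + (\<Sum>e<M. i e) + (\<Sum>e<M + d. s e)" for M
  proof (induction M)
    case 0
    show ?case using assms(3) by (simp add: sum_mono)
  next
    case (Suc M)
    show ?case using Suc.IH assms(4)[of M] by simp
  qed
  \<comment> \<open>The window from \<open>M\<close> to \<open>M + d - 1\<close> has
    \<open>d\<close> terms, each contributing at most \<open>r\<close>.\<close>
  have tail: "(\<Sum>e<M + d. s e) + (\<Sum>e<M. i e) \<le> d * r + (\<Sum>e<M. s e) + (\<Sum>e<M + d. i e)"
  proof (induction d)
    case (Suc d)
    show ?case using Suc.IH assms(1)[of "M + d"] by simp
  qed simp
  show ?thesis using shift[of M] tail by linarith
qed

lemma annihilator_degree_le:
  fixes F :: "('v::finite, 'k::field) mpoly"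
  assumes F: "F \<noteq> 0" "homogeneous m F" and gen: "generated_in_degree d (annihilator F)"
    and I: "homogeneous_ideal I" "saturated I" "proj_dim I = 0" "I \<subseteq> annihilator F" "has_scheme_degree I r"
  shows "annihilator_degree F \<le> d * r"
proof -
  let ?J = "annihilator F" and ?S = "\<lambda>e. {p :: ('v, 'k) mpoly. homogeneous e p}"
  obtain G where G: "\<And>g. g \<in> G \<Longrightarrow> \<exists>e\<le>d. homogeneous e g" "?J = Idl\<^bsub>\<S>\<^esub> G"
    using gen unfolding generated_in_degree_def by metis
  have J: "homogeneous_ideal ?J" unfolding G(2) using G(1) by (intro homogeneous_ideal_Idl) blast
  \<comment> \<open>The exponent \<open>Suc m\<close> exceeds the degree of \<open>F\<close>.
    Because of these powers \<open>J\<close> has no zero in projective space.\<close>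
  have vars: "\<exists>k. var i ^ k \<in> ?J" for i
  proof
    have "homogeneous (Suc m) (var i ^ Suc m :: ('v, 'k) mpoly)" by (rule homogeneous_var_power)
    then show "var i ^ Suc m \<in> ?J"
      unfolding homogeneous_lookup by (intro mem_annihilator_if_large_degree[OF F(2)]) simp
  qed
  have sub: "mp.subspace (Y \<inter> ?S e)" if "homogeneous_ideal Y" for Y e
    using mp.subspace_inter[OF subspace_ideal[OF that] subspace_homogeneous] .
  have mono: "mp.dim Y \<le> mp.dim Z" if YZ: "mp.subspace Y" "mp.subspace Z" "Y \<subseteq> Z" "Z \<subseteq> ?S e" for Y Z e
  proof -
    have "Z \<subseteq> mp.span (monomials_upto e)" using YZ(4) homogeneous_span by (rule subset_trans)
    from mp.complement_basis[OF YZ(1,2,3) finite_monomials_upto this]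
    show ?thesis by (metis le_add2)
  qed
  \<comment> \<open>The range ends at degree \<open>m + d\<close>, and \<open>S\<close> and
    \<open>J\<close> agree in all degrees beyond \<open>m\<close>; hence the two sums differ by
    exactly \<open>annihilator_degree F\<close>.\<close>
  have bound: "(\<Sum>e<Suc m + d. mp.dim (?S e)) \<le> d * r + (\<Sum>e<Suc m + d. mp.dim (?J \<inter> ?S e))"
  proof (rule sum_telescope_le)
    show "mp.dim (?S e) \<le> r + mp.dim (I \<inter> ?S e)" for e
      by (rule hilbert_function_le_scheme_degree[OF I(1,3,2,5)])
    show "mp.dim (I \<inter> ?S e) \<le> mp.dim (?S e)" for e
      by (rule mono[OF sub[OF I(1)] subspace_homogeneous]) auto
    show "mp.dim (I \<inter> ?S e) \<le> mp.dim (?J \<inter> ?S e)" for e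
      by (rule mono[OF sub[OF I(1)] sub[OF J]]) (use I(4) in auto)
    show "mp.dim (?S e) + mp.dim (I \<inter> ?S (e + d)) \<le> mp.dim (?J \<inter> ?S (e + d)) + mp.dim (I \<inter> ?S e)" for e
      by (rule hilbert_function_step[OF I(1,2,4) G vars])
  qed
  have eq: "{..<Suc m + d} = {..m + d}" by auto
  show ?thesis using bound[unfolded eq] annihilator_degree_eq[OF F J le_add1, of d] by linarith
qed

section \<open>Fat points\<close>

text \<open>The degree in all variables but the \<open>i\<close>-th: the order of vanishing of a
  monomial at the coordinate point where only \<open>var i\<close> is non-zero.\<close>

definition weight_off :: "'v \<Rightarrow> ('v::finite \<Rightarrow>\<^sub>0 nat) \<Rightarrow> nat"
  where "weight_off i \<alpha> = (\<Sum>j\<in>UNIV - {i}. Poly_Mapping.lookup \<alpha> j)"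

lemma weight_off_add [simp]: "weight_off i (\<alpha> + \<beta>) = weight_off i \<alpha> + weight_off i \<beta>"
  by (simp add: weight_off_def lookup_add sum.distrib)

lemma weight_off_single [simp]: "weight_off i (Poly_Mapping.single j k) = (if j = i then 0 else k)"
proof -
  have "weight_off i (Poly_Mapping.single j k) = (\<Sum>l\<in>UNIV - {i}. if l = j then k else 0)"
    unfolding weight_off_def lookup_single when_def by (rule sum.cong) auto
  then show ?thesis by simp
qed

lemma mdeg_weight_off: "mdeg \<alpha> = Poly_Mapping.lookup \<alpha> i + weight_off i \<alpha>"
  unfolding mdeg_def weight_off_def by (rule sum.remove) auto

text \<open>The \<open>N\<close>-th power of the ideal of that coordinate point. It is a monomial
  ideal, so membership can be read off coefficient by coefficient.\<close>

definition fat_point :: "'v \<Rightarrow> nat \<Rightarrow> ('v::finite, 'k::field) mpoly set"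
  where "fat_point i N = {p. \<forall>\<alpha>. weight_off i \<alpha> < N \<longrightarrow> Poly_Mapping.lookup p \<alpha> = 0}"

lemma single_mem_fat_point: "weight_off i \<alpha> \<ge> N \<Longrightarrow> Poly_Mapping.single \<alpha> c \<in> fat_point i N"
  by (auto simp: fat_point_def lookup_single when_def)

lemma fat_point_mult:
  assumes "p \<in> fat_point i M" "q \<in> fat_point i N" shows "p * q \<in> fat_point i (M + N)"
  unfolding fat_point_def
proof (intro CollectI allI impI, rule ccontr)
  fix \<alpha> assume \<alpha>: "weight_off i \<alpha> < M + N" "Poly_Mapping.lookup (p * q) \<alpha> \<noteq> 0"
  then have "\<alpha> \<in> Poly_Mapping.keys (p * q)" by (simp add: in_keys_iff)
  then obtain \<beta> \<gamma> where bc: "\<beta> \<in> Poly_Mapping.keys p" "\<gamma> \<in> Poly_Mapping.keys q" "\<alpha> = \<beta> + \<gamma>"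
    using keys_mult[of p q] by blast
  then have "\<not> weight_off i \<beta> < M" "\<not> weight_off i \<gamma> < N"
    using assms unfolding fat_point_def in_keys_iff by blast+
  then show False using \<alpha>(1) bc(3) by simp
qed

lemma fat_point_zero [simp]: "fat_point i 0 = UNIV"
  by (simp add: fat_point_def)

lemma fat_point_power: "p \<in> fat_point i 1 \<Longrightarrow> p ^ N \<in> fat_point i N"
proof (induction N)
  case (Suc N)
  then show ?case using fat_point_mult[of p i 1 "p ^ N" N] by simp
qed simp

lemma homogeneous_ideal_fat_point: "homogeneous_ideal (fat_point i N)"
  unfolding homogeneous_ideal_iff
proof (intro conjI ballI allI)
  fix p :: "('a, 'b) mpoly" assume p: "p \<in> fat_point i N"
  show "r * p \<in> fat_point i N" for r using fat_point_mult[of r i 0 p N] p by simp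
qed (auto simp: fat_point_def lookup_add lookup_hcomp)

lemma lookup_single_mult: "Poly_Mapping.lookup (Poly_Mapping.single \<beta> c * p) (\<beta> + \<alpha>) = c * Poly_Mapping.lookup p \<alpha>"
  for p :: "('v, 'k::field) mpoly"
proof (induction p rule: mpoly_induct)
  case (2 \<gamma> d)
  show ?case by (simp add: mult_single lookup_single when_def)
qed (simp_all add: lookup_add algebra_simps)

lemma var_power: "var i ^ k = Poly_Mapping.single (Poly_Mapping.single i k) 1"
proof (induction k)
  case (Suc k)
  then show ?case by (simp add: var_def mult_single flip: single_add)
qed simp

text \<open>Multiplication by a power of \<open>var i\<close> shifts monomials without changing
  their weight, so this variable already detects membership.\<close>

lemma saturated_fat_point: "saturated (fat_point i N :: ('v::finite, 'k::field) mpoly set)"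
  unfolding saturated_def
proof (intro allI impI)
  fix p :: "('v, 'k) mpoly" assume "\<forall>j. \<exists>k. var j ^ k * p \<in> fat_point i N"
  then obtain k where k: "var i ^ k * p \<in> fat_point i N" by blast
  show "p \<in> fat_point i N"
    unfolding fat_point_def
  proof (intro CollectI allI impI)
    fix \<alpha> assume "weight_off i \<alpha> < N"
    then have "Poly_Mapping.lookup (var i ^ k * p) (Poly_Mapping.single i k + \<alpha>) = 0"
      using k unfolding fat_point_def by simp
    then show "Poly_Mapping.lookup p \<alpha> = 0" unfolding var_power lookup_single_mult by simp
  qed
qed

text \<open>Weight is at most degree, so weight above \<open>m\<close> forces degree above
  \<open>m\<close>; this fixes the multiplicity \<open>Suc m\<close>.\<close>

lemma fat_point_subset_annihilator:
  fixes F :: "('v::finite, 'k::field) mpoly"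
  assumes "homogeneous m F" shows "fat_point i (Suc m) \<subseteq> annihilator F"
proof
  fix g :: "('v, 'k) mpoly" assume g: "g \<in> fat_point i (Suc m)"
  show "g \<in> annihilator F"
  proof (rule mem_annihilator_if_large_degree[OF assms])
    fix \<alpha> :: "'v \<Rightarrow>\<^sub>0 nat" assume "mdeg \<alpha> \<le> m"
    then have "weight_off i \<alpha> < Suc m" using mdeg_weight_off[of \<alpha> i] by simp
    then show "Poly_Mapping.lookup g \<alpha> = 0" using g unfolding fat_point_def by blast
  qed
qed

text \<open>The coefficient of \<open>var i ^ k\<close> is the value of the form at the coordinate
  point; removing that term leaves a form vanishing there.\<close>

lemma homogeneous_mod_fat_point_one:
  assumes f: "homogeneous k f"
  shows "f - const (Poly_Mapping.lookup f (Poly_Mapping.single i k)) * var i ^ k \<in> fat_point i 1"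
  unfolding fat_point_def
proof (intro CollectI allI impI)
  fix \<alpha> assume "weight_off i \<alpha> < 1"
  then have w: "weight_off i \<alpha> = 0" by simp
  show "Poly_Mapping.lookup (f - const (Poly_Mapping.lookup f (Poly_Mapping.single i k)) * var i ^ k) \<alpha> = 0"
  proof (cases "mdeg \<alpha> = k")
    case True
    have "Poly_Mapping.lookup \<alpha> j = Poly_Mapping.lookup (Poly_Mapping.single i k) j" for j
    proof (cases "j = i")
      case True
      then show ?thesis using w mdeg_weight_off[of \<alpha> i] \<open>mdeg \<alpha> = k\<close> by simp
    next
      case False
      then have "Poly_Mapping.lookup \<alpha> j = 0" using w unfolding weight_off_def by simp
      then show ?thesis using False by (simp add: lookup_single when_def)
    qed
    then have "\<alpha> = Poly_Mapping.single i k" by (rule poly_mapping_eqI)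
    then show ?thesis by (simp add: lookup_minus lookup_const_mult var_power)
  next
    case False
    then have "Poly_Mapping.lookup f \<alpha> = 0" "Poly_Mapping.single i k \<noteq> \<alpha>"
      using f by (auto simp: homogeneous_lookup)
    then show ?thesis by (simp add: lookup_minus lookup_const_mult var_power lookup_single when_def)
  qed
qed

text \<open>A point contains a power of each \<open>var j\<close> with \<open>j \<noteq> i\<close>,
  hence all of \<open>fat_point i 1\<close>, and so cannot contain \<open>var i\<close>. Modulo
  \<open>fat_point i 1\<close> a form is a multiple of a power of \<open>var i\<close>, so nothing
  more fits into the prime.\<close>

lemma proj_fat_point:
  assumes N: "N \<ge> 1"
  shows "proj (fat_point i N) = {fat_point i 1 :: ('v::finite, 'k::field) mpoly set}"
proof -
  let ?I = "fat_point i N :: ('v, 'k) mpoly set" and ?P = "fat_point i 1 :: ('v, 'k) mpoly set"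
  have unique: "Q = ?P" if Q: "Q \<in> proj ?I" for Q
  proof
    note QD = homogeneous_idealD[OF projD(1)[OF Q]]
    have var: "var j \<in> Q" if j: "j \<noteq> i" for j
    proof (rule ccontr)
      assume "var j \<notin> Q"
      then have "var j ^ N \<notin> Q" by (rule proj_power_notin[OF Q])
      moreover have "var j ^ N \<in> ?I" unfolding var_power by (rule single_mem_fat_point) (simp add: j)
      ultimately show False using projD(3)[OF Q] by blast
    qed
    have "Poly_Mapping.single \<alpha> c \<in> Q" if \<alpha>: "weight_off i \<alpha> \<ge> 1" for \<alpha> c
    proof -
      have "\<exists>j\<in>UNIV - {i}. Poly_Mapping.lookup \<alpha> j \<noteq> 0"
      proof (rule ccontr)
        assume "\<not> ?thesis"
        then have "weight_off i \<alpha> = 0" unfolding weight_off_def by (intro sum.neutral) blast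
        then show False using \<alpha> by simp
      qed
      then obtain j where j: "j \<noteq> i" "Poly_Mapping.lookup \<alpha> j \<noteq> 0" by blast
      have "\<alpha> = (\<alpha> - Poly_Mapping.single j 1) + Poly_Mapping.single j 1"
        using j(2) by (intro poly_mapping_eqI) (auto simp: lookup_add lookup_minus lookup_single when_def)
      then have "Poly_Mapping.single \<alpha> c = Poly_Mapping.single (\<alpha> - Poly_Mapping.single j 1) c * var j"
        by (metis var_def mult_single mult.right_neutral)
      then show ?thesis using QD(3)[OF var[OF j(1)]] by simp
    qed
    then show PQ: "?P \<subseteq> Q"
    proof (intro subsetI)
      fix p assume p: "p \<in> ?P"
      have "p = (\<Sum>\<alpha>\<in>Poly_Mapping.keys p. Poly_Mapping.single \<alpha> (Poly_Mapping.lookup p \<alpha>))"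
        by (rule poly_mapping_eqI) (auto simp: lookup_sum lookup_single when_def in_keys_iff)
      also have "\<dots> \<in> Q"
      proof (rule homogeneous_ideal_sum[OF projD(1)[OF Q]])
        fix \<alpha> assume "\<alpha> \<in> Poly_Mapping.keys p"
        then have "\<not> weight_off i \<alpha> < 1" using p unfolding fat_point_def in_keys_iff by blast
        then show "Poly_Mapping.single \<alpha> (Poly_Mapping.lookup p \<alpha>) \<in> Q"
          using \<open>\<And>\<alpha> c. weight_off i \<alpha> \<ge> 1 \<Longrightarrow> Poly_Mapping.single \<alpha> c \<in> Q\<close> by simp
      qed
      finally show "p \<in> Q" .
    qed
    have vi: "var i \<notin> Q"
    proof -
      obtain j where j: "var j \<notin> Q" using projD(4)[OF Q] by (rule exE)
      then have "j = i" using var[of j] by (rule contrapos_np)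
      then show ?thesis using j by simp
    qed
    have comp: "hcomp e q \<in> ?P" if q: "q \<in> Q" for q e
    proof -
      define c where "c = Poly_Mapping.lookup (hcomp e q) (Poly_Mapping.single i e)"
      have d: "hcomp e q - const c * var i ^ e \<in> ?P"
        unfolding c_def by (rule homogeneous_mod_fat_point_one) simp
      then have "hcomp e q - (hcomp e q - const c * var i ^ e) \<in> Q" using PQ QD(5,6) q by blast
      then have cQ: "const c * var i ^ e \<in> Q" by simp
      have "c = 0"
      proof (rule ccontr)
        assume "c \<noteq> 0"
        then have "const (inverse c) * (const c * var i ^ e) = var i ^ e"
          by (simp flip: mult.assoc)
        then have "var i ^ e \<in> Q" using QD(3)[OF cQ] by metis
        then show False using proj_power_notin[OF Q vi] by blast
      qed
      then show ?thesis using d by simp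
    qed
    show "Q \<subseteq> ?P"
      using homogeneous_ideal_hcompI[OF homogeneous_ideal_fat_point] comp by blast
  qed
  \<comment> \<open>With no points at all, \<open>saturated_memI\<close> would put \<open>1\<close>
    into the ideal. Together with uniqueness this shows indirectly that \<open>fat_point i 1\<close>
    is prime.\<close>
  have "proj ?I \<noteq> {}"
  proof
    assume "proj ?I = {}"
    then have "1 \<in> ?I"
      by (intro saturated_memI[OF homogeneous_ideal_fat_point saturated_fat_point homogeneous_one]) simp
    moreover have "weight_off i 0 < N" using N by (simp add: weight_off_def)
    ultimately have "Poly_Mapping.lookup (1 :: ('v, 'k) mpoly) 0 = 0"
      unfolding fat_point_def by blast
    then show False by (simp add: lookup_one)
  qed
  then show ?thesis using unique by blast
qed

text \<open>A monomial of degree \<open>K + N\<close> and weight below \<open>N\<close> is divisible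
  by \<open>var i ^ K\<close>, and the other monomials lie in the fat point. This clears powers of
  \<open>var i\<close> from denominators.\<close>

lemma fat_point_divide_var_power:
  fixes q :: "('v::finite, 'k::field) mpoly"
  assumes q: "homogeneous (K + N) q"
  obtains b where "homogeneous N b" "q - var i ^ K * b \<in> fat_point i N"
proof -
  define A where "A = {\<alpha> \<in> Poly_Mapping.keys q. weight_off i \<alpha> < N}"
  define b where "b = (\<Sum>\<alpha>\<in>A. Poly_Mapping.single (\<alpha> - Poly_Mapping.single i K) (Poly_Mapping.lookup q \<alpha>))"
  have fA: "finite A" unfolding A_def by simp
  have split: "Poly_Mapping.single i K + (\<alpha> - Poly_Mapping.single i K) = \<alpha>" "mdeg (\<alpha> - Poly_Mapping.single i K) = N"
    if \<alpha>: "\<alpha> \<in> A" for \<alpha>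
  proof -
    have "mdeg \<alpha> = K + N" using \<alpha> q by (auto simp: A_def homogeneous_def)
    then have "K \<le> Poly_Mapping.lookup \<alpha> i" using mdeg_weight_off[of \<alpha> i] \<alpha> by (simp add: A_def)
    then show *: "Poly_Mapping.single i K + (\<alpha> - Poly_Mapping.single i K) = \<alpha>"
      by (intro poly_mapping_eqI) (auto simp: lookup_add lookup_minus lookup_single when_def)
    from arg_cong[OF *, of mdeg] show "mdeg (\<alpha> - Poly_Mapping.single i K) = N"
      using \<open>mdeg \<alpha> = K + N\<close> by simp
  qed
  have "homogeneous N b"
    unfolding b_def by (rule homogeneous_sum) (metis homogeneous_single split(2))
  moreover have "q - var i ^ K * b \<in> fat_point i N"
  proof -
    have "var i ^ K * b = (\<Sum>\<alpha>\<in>A. Poly_Mapping.single \<alpha> (Poly_Mapping.lookup q \<alpha>))"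
      unfolding b_def var_power sum_distrib_left by (rule sum.cong) (simp_all add: mult_single split(1))
    then have "Poly_Mapping.lookup (var i ^ K * b) \<alpha> = (if \<alpha> \<in> A then Poly_Mapping.lookup q \<alpha> else 0)" for \<alpha>
      using fA by (simp add: lookup_sum lookup_single when_def)
    then show ?thesis unfolding fat_point_def by (auto simp: lookup_minus A_def in_keys_iff)
  qed
  ultimately show thesis by (rule that)
qed

text \<open>There is one point, so a section is a single germ \<open>a/f\<close>. Its denominator is
  a non-zero multiple of \<open>var i ^ k\<close> plus a nilpotent part; a finite geometric sum
  replaces it by a power of \<open>var i\<close>, most of which then divides out.\<close>

lemma fat_point_twisted_section_surj:
  fixes s :: "('v::finite, 'k::field) mpoly set \<Rightarrow> (('v, 'k) mpoly \<times> ('v, 'k) mpoly) set"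
  assumes N: "N \<ge> 1" and s: "s \<in> sections (fat_point i N)"
  shows "\<exists>b. homogeneous N b \<and> s = twisted_section (fat_point i N) N b"
proof -
  let ?I = "fat_point i N :: ('v, 'k) mpoly set" and ?P = "fat_point i 1 :: ('v, 'k) mpoly set" and ?y = "var i :: ('v, 'k) mpoly"
  have I: "homogeneous_ideal ?I" "proj_dim ?I = 0"
    using homogeneous_ideal_fat_point proj_dim_singleton[OF proj_fat_point[OF N]] by blast+
  note ID = homogeneous_idealD[OF I(1)]
  have PI: "proj ?I = {?P}" by (rule proj_fat_point[OF N])
  then have P: "?P \<in> proj ?I" by simp
  have yj: "var j \<in> ?P" if "j \<noteq> i" for j
    unfolding var_def by (rule single_mem_fat_point) (simp add: that)
  have y: "var j \<notin> ?P \<longleftrightarrow> j = i" for j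
  proof -
    obtain k where k: "var k \<notin> ?P" using projD(4)[OF P] by (rule exE)
    then have "k = i" using yj[of k] by (rule contrapos_np)
    then show ?thesis using k yj[of j] by (cases "j = i") simp_all
  qed
  obtain a f where af: "(a, f) \<in> fractions ?P" "s ?P = fraction_class ?I ?P a f" by (rule section_rep[OF s P])
  obtain k where k: "f \<notin> ?P" "homogeneous k a" "homogeneous k f" by (rule fractionsE[OF af(1)])
  define c where "c = Poly_Mapping.lookup f (Poly_Mapping.single i k)"
  define x where "x = const c * ?y ^ k"
  have fx: "f - x \<in> ?P" unfolding x_def c_def by (rule homogeneous_mod_fat_point_one[OF k(3)])
  have "c \<noteq> 0" using fx k(1) unfolding x_def by auto
  have hx: "homogeneous k x" unfolding x_def by (intro homogeneous_scale homogeneous_var_power)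
  have xf: "x - f \<in> ?P" using homogeneous_idealD(7)[OF projD(1)[OF P] fx] by simp
  \<comment> \<open>The cofactor of \<open>f\<close> in \<open>x ^ N - (x - f) ^ N\<close>. Since
    \<open>(x - f) ^ N\<close> lies in the fat point, \<open>g / x ^ N\<close> serves as inverse of
    \<open>f\<close>.\<close>
  define g where "g = (\<Sum>l<N. (x - f) ^ (N - Suc l) * x ^ l)"
  have xN: "x ^ N - f * g \<in> ?I"
  proof -
    have "x ^ N - (x - f) ^ N = f * g" unfolding power_diff_sumr2 g_def by simp
    then have "x ^ N - f * g = (x - f) ^ N" by (simp add: algebra_simps)
    then show ?thesis using fat_point_power[OF xf, of N] by simp
  qed
  have hg: "homogeneous ((N - 1) * k) g"
    unfolding g_def
  proof (rule homogeneous_sum)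
    fix l assume "l \<in> {..<N}"
    then have "(N - Suc l) * k + l * k = (N - 1) * k" by (simp flip: add_mult_distrib)
    then show "homogeneous ((N - 1) * k) ((x - f) ^ (N - Suc l) * x ^ l)"
      using homogeneous_mult[OF homogeneous_power[OF homogeneous_diff[OF hx k(3)], of "N - Suc l"] homogeneous_power[OF hx, of l]]
      by simp
  qed
  \<comment> \<open>The numerator of \<open>a * g / x ^ N\<close> expanded by \<open>?y ^ N\<close>.
    The extra factor raises the degree to \<open>N * k + N\<close>, so that dividing out
    \<open>?y ^ (N * k)\<close> leaves a form \<open>b\<close> of degree \<open>N\<close> over
    \<open>?y ^ N\<close>.\<close>
  define q where "q = const (inverse c ^ N) * (a * g * ?y ^ N)"
  have "k + (N - 1) * k = N * k" using N by (cases N) auto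
  then have "homogeneous (N * k + N) q"
    unfolding q_def using homogeneous_scale[OF homogeneous_mult[OF homogeneous_mult[OF k(2) hg] homogeneous_var_power[of N i]]] by simp
  then obtain b where b: "homogeneous N b" "q - ?y ^ (N * k) * b \<in> ?I" by (rule fat_point_divide_var_power)
  have cN: "const (inverse c ^ N) * x ^ N = ?y ^ (N * k)"
  proof -
    have "const (inverse c ^ N) * x ^ N = (const (inverse c) * const c) ^ N * (?y ^ k) ^ N"
      unfolding x_def const_power by (simp add: power_mult_distrib algebra_simps)
    also have "\<dots> = (?y ^ k) ^ N" unfolding const_inverse[OF \<open>c \<noteq> 0\<close>] by simp
    also have "\<dots> = ?y ^ (N * k)" by (simp only: mult.commute[of N k] power_mult)
    finally show ?thesis .
  qed
  have "?y ^ (N * k) * (a * ?y ^ N - b * f) =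
      const (inverse c ^ N) * (a * ?y ^ N) * (x ^ N - f * g) + f * (q - ?y ^ (N * k) * b)"
    unfolding q_def cN[symmetric] by (simp add: algebra_simps)
  also have "\<dots> \<in> ?I" using ID(2,3) xN b(2) by simp
  finally have mem: "?y ^ (N * k) * (a * ?y ^ N - b * f) \<in> ?I" .
  have some: "(SOME j. var j \<notin> ?P) = i" unfolding y by simp
  have tb: "(b, ?y ^ N) \<in> fractions ?P" using twisted_fraction[OF I P b(1)] unfolding some .
  have "(b, ?y ^ N) \<in> fraction_class ?I ?P a f"
  proof (rule mem_fraction_classI[OF tb homogeneous_var_power _ mem])
    have "?y \<notin> ?P" using y by blast
    then show "?y ^ (N * k) \<notin> ?P" by (rule proj_power_notin[OF P])
  qed
  then have "s ?P = fraction_class ?I ?P b (?y ^ N)"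
    using fraction_class_eq_iff[OF I(1) P af(1) tb] af(2) by blast
  then have eq: "s ?P = twisted_section ?I N b ?P"
    unfolding twisted_section_def restrict_apply'[OF P] some .
  have "s = twisted_section ?I N b"
    by (rule sections_ext[OF s twisted_section_mem[OF I b(1)]]) (simp only: PI singleton_iff eq)
  then show ?thesis using b(1) by blast
qed

lemma ex_apolar_scheme:
  fixes F :: "('v::finite, 'k::field) mpoly"
  assumes "homogeneous m F"
  shows "\<exists>r I. homogeneous_ideal I \<and> saturated I \<and> proj_dim I = 0 \<and> I \<subseteq> annihilator F \<and> has_scheme_degree I r"
proof -
  \<comment> \<open>\<open>undefined\<close> stands for an arbitrary index. The multiplicity exceeds
    the degree of \<open>F\<close> by one, which puts the ideal inside the annihilator.\<close>
  let ?I = "fat_point undefined (Suc m) :: ('v, 'k) mpoly set"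
  have I: "homogeneous_ideal ?I" "proj_dim ?I = 0"
    using homogeneous_ideal_fat_point proj_dim_singleton[OF proj_fat_point[of "Suc m"]] by simp_all
  have "\<exists>r. has_scheme_degree ?I r"
    by (rule has_scheme_degree_exI[OF I saturated_fat_point]) (rule fat_point_twisted_section_surj, simp)
  then show ?thesis using I saturated_fat_point fat_point_subset_annihilator[OF assms] by blast
qed

theorem corollary1:
  fixes F :: "('v::finite, 'k::field) mpoly" and m d :: nat
  assumes "F \<noteq> 0"
    and "homogeneous m F"
    and "d \<ge> 1"
    and "generated_in_degree d (annihilator F)"
  shows "real (cactus_rank F) \<ge> 1 / real d * real (annihilator_degree F)"
proof -
  have "\<exists>I. homogeneous_ideal I \<and> saturated I \<and> proj_dim I = 0 \<and> I \<subseteq> annihilator F \<and>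
      has_scheme_degree I (cactus_rank F)"
    unfolding cactus_rank_def by (rule LeastI_ex[OF ex_apolar_scheme[OF assms(2)]])
  then obtain I where I: "homogeneous_ideal I" "saturated I" "proj_dim I = 0" "I \<subseteq> annihilator F"
    "has_scheme_degree I (cactus_rank F)" by blast
  have "real (annihilator_degree F) \<le> real (d * cactus_rank F)"
    using annihilator_degree_le[OF assms(1,2,4) I] by (rule of_nat_mono)
  then show ?thesis using assms(3) by (simp add: field_simps)
qed

end
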